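(* Let $R=k[x_1,\dots,x_d]$ be a polynomial ring over an infinite field $k$. Let $I=\bigcap_{i=1}^n p_i$, where each $p_i$ is an ideal generated by a set of variables (a subset of $\{x_1,\dots,x_d\}$), and the generating sets of variables of $p_i$ and $p_j$ are disjoint for $i\neq j$. Let $a=\sum_{i=1}^d\alpha_i x_i$ be a general linear form. Then $(I+(a))/(a)$ is an integrally closed ideal of $R/(a)$.
   Context: An ideal $J$ of a commutative ring $S$ is integrally closed if $J=\overline{J}$, where $\overline{J}=\{y\in S \mid y^m+c_1y^{m-1}+\cdots+c_m=0 \text{ for some } m\geq 1 \text{ and some } c_i\in J^i\}$ is the integral closure of $J$. A property holds for a general linear form $a=\sum_{i=1}^d\alpha_i x_i$ (i.e. a general element of the ideal $(x_1,\dots,x_d)$) if there is a dense (Zariski) open subset $U$ of $k^d$ such that the property holds whenever $(\alpha_1,\dots,\alpha_d)\in U$. *)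

theory Defs
  imports
    "HOL-Library.Poly_Mapping"
    "HOL-Library.FuncSet"
    "HOL-Algebra.Ideal_Product"
    "HOL-Algebra.QuotRing"
    "HOL-Analysis.Abstract_Topology"
begin

section \<open>The polynomial ring in d variables\<close>

text \<open>A monomial is an exponent vector of type \<^typ>\<open>nat \<Rightarrow>\<^sub>0 nat\<close>, and a polynomial is a finitely
  supported family of coefficients indexed by monomials, so that the multiplication of
  \<^typ>\<open>(nat \<Rightarrow>\<^sub>0 nat) \<Rightarrow>\<^sub>0 'k\<close> is the multiplication of polynomials in countably many variables.
  The ring in the variables of index 1, ..., d is cut out by its carrier.\<close>

definition polynomial_ring :: "nat \<Rightarrow> ((nat \<Rightarrow>\<^sub>0 nat) \<Rightarrow>\<^sub>0 'k::field) ring" where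
  "polynomial_ring d =
    \<lparr>carrier = {p. \<forall>m \<in> Poly_Mapping.keys p. Poly_Mapping.keys m \<subseteq> {1..d}},
     monoid.mult = (*), one = 1, zero = 0, add = (+)\<rparr>"

definition Const :: "'k::field \<Rightarrow> (nat \<Rightarrow>\<^sub>0 nat) \<Rightarrow>\<^sub>0 'k" where
  "Const c = Poly_Mapping.single 0 c"

definition Var :: "nat \<Rightarrow> (nat \<Rightarrow>\<^sub>0 nat) \<Rightarrow>\<^sub>0 'k::field" where
  "Var i = Poly_Mapping.single (Poly_Mapping.single i 1) 1"

definition linear_form :: "nat \<Rightarrow> (nat \<Rightarrow> 'k::field) \<Rightarrow> (nat \<Rightarrow>\<^sub>0 nat) \<Rightarrow>\<^sub>0 'k" where
  "linear_form d \<alpha> = (\<Sum>i=1..d. Const (\<alpha> i) * Var i)"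

lemma polynomial_ring_simps [simp]:
  "carrier (polynomial_ring d) = {p. \<forall>m \<in> Poly_Mapping.keys p. Poly_Mapping.keys m \<subseteq> {1..d}}"
  "x \<otimes>\<^bsub>polynomial_ring d\<^esub> y = x * y"
  "\<one>\<^bsub>polynomial_ring d\<^esub> = 1"
  "\<zero>\<^bsub>polynomial_ring d\<^esub> = 0"
  "x \<oplus>\<^bsub>polynomial_ring d\<^esub> y = x + y"
  by (simp_all add: polynomial_ring_def)

lemma polynomial_mult_closed:
  fixes p q :: "(nat \<Rightarrow>\<^sub>0 nat) \<Rightarrow>\<^sub>0 'k::field"
  assumes "p \<in> carrier (polynomial_ring d)" "q \<in> carrier (polynomial_ring d)"
  shows "p * q \<in> carrier (polynomial_ring d)"
proof -
  have "Poly_Mapping.keys m \<subseteq> {1..d}" if m: "m \<in> Poly_Mapping.keys (p * q)" for m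
  proof -
    obtain a b where "m = a + b" "a \<in> Poly_Mapping.keys p" "b \<in> Poly_Mapping.keys q"
      using m keys_mult[of p q] by blast
    then show ?thesis
      using assms Poly_Mapping.keys_add[of a b] by fastforce
  qed
  then show ?thesis by simp
qed

lemma polynomial_ring_cring:
  "cring (polynomial_ring d :: ((nat \<Rightarrow>\<^sub>0 nat) \<Rightarrow>\<^sub>0 'k::field) ring)"
proof (rule cringI)
  show "abelian_group (polynomial_ring d :: ((nat \<Rightarrow>\<^sub>0 nat) \<Rightarrow>\<^sub>0 'k) ring)"
  proof (rule abelian_groupI)
    fix x y :: "(nat \<Rightarrow>\<^sub>0 nat) \<Rightarrow>\<^sub>0 'k"
    assume "x \<in> carrier (polynomial_ring d)" "y \<in> carrier (polynomial_ring d)"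
    then show "x \<oplus>\<^bsub>polynomial_ring d\<^esub> y \<in> carrier (polynomial_ring d)"
      using Poly_Mapping.keys_add[of x y] by fastforce
  next
    fix x :: "(nat \<Rightarrow>\<^sub>0 nat) \<Rightarrow>\<^sub>0 'k"
    assume "x \<in> carrier (polynomial_ring d)"
    then show "\<exists>y \<in> carrier (polynomial_ring d). y \<oplus>\<^bsub>polynomial_ring d\<^esub> x = \<zero>\<^bsub>polynomial_ring d\<^esub>"
      by (intro bexI[of _ "- x"]) auto
  qed (auto simp: algebra_simps)
  show "Group.comm_monoid (polynomial_ring d :: ((nat \<Rightarrow>\<^sub>0 nat) \<Rightarrow>\<^sub>0 'k) ring)"
  proof (rule comm_monoidI)
    fix x y :: "(nat \<Rightarrow>\<^sub>0 nat) \<Rightarrow>\<^sub>0 'k"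
    assume "x \<in> carrier (polynomial_ring d)" "y \<in> carrier (polynomial_ring d)"
    then show "x \<otimes>\<^bsub>polynomial_ring d\<^esub> y \<in> carrier (polynomial_ring d)"
      using polynomial_mult_closed[of x d y] by simp
  qed (simp_all add: mult_ac)
qed (auto simp: algebra_simps)

section \<open>Integrally closed ideals\<close>

text \<open>The power of an ideal is its power in the multiplicative monoid of all ideals.\<close>

definition ideal_power :: "('a, 'b) ring_scheme \<Rightarrow> 'a set \<Rightarrow> nat \<Rightarrow> 'a set" where
  "ideal_power S J i = J [^]\<^bsub>ideals_set S\<^esub> i"

definition integral_closure :: "('a, 'b) ring_scheme \<Rightarrow> 'a set \<Rightarrow> 'a set" where
  "integral_closure S J =
    {y \<in> carrier S. \<exists>m\<ge>1. \<exists>c. (\<forall>i\<in>{1..m}. c i \<in> ideal_power S J i) \<and>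
       y [^]\<^bsub>S\<^esub> (m::nat) \<oplus>\<^bsub>S\<^esub> (\<Oplus>\<^bsub>S\<^esub>i\<in>{1..m}. c i \<otimes>\<^bsub>S\<^esub> y [^]\<^bsub>S\<^esub> (m - i)) = \<zero>\<^bsub>S\<^esub>}"

definition integrally_closed_ideal :: "('a, 'b) ring_scheme \<Rightarrow> 'a set \<Rightarrow> bool" where
  "integrally_closed_ideal S J \<longleftrightarrow> ideal J S \<and> J = integral_closure S J"

section \<open>General linear forms\<close>

definition affine_space :: "nat \<Rightarrow> (nat \<Rightarrow> 'k::field) set" where
  "affine_space d = {1..d} \<rightarrow>\<^sub>E UNIV"

definition monom_eval :: "(nat \<Rightarrow> 'k::field) \<Rightarrow> (nat \<Rightarrow>\<^sub>0 nat) \<Rightarrow> 'k" where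
  "monom_eval \<alpha> m = (\<Prod>i\<in>Poly_Mapping.keys m. \<alpha> i ^ Poly_Mapping.lookup m i)"

definition poly_eval :: "(nat \<Rightarrow> 'k::field) \<Rightarrow> ((nat \<Rightarrow>\<^sub>0 nat) \<Rightarrow>\<^sub>0 'k) \<Rightarrow> 'k" where
  "poly_eval \<alpha> p = (\<Sum>m\<in>Poly_Mapping.keys p. Poly_Mapping.lookup p m * monom_eval \<alpha> m)"

definition zero_locus :: "nat \<Rightarrow> ((nat \<Rightarrow>\<^sub>0 nat) \<Rightarrow>\<^sub>0 'k::field) set \<Rightarrow> (nat \<Rightarrow> 'k) set" where
  "zero_locus d F = {\<alpha> \<in> affine_space d. \<forall>f\<in>F. poly_eval \<alpha> f = 0}"

definition zariski_open :: "nat \<Rightarrow> (nat \<Rightarrow> 'k::field) set \<Rightarrow> bool" where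
  "zariski_open d U \<longleftrightarrow>
    (\<exists>F \<subseteq> carrier (polynomial_ring d). U = affine_space d - zero_locus d F)"

definition zariski_topology :: "nat \<Rightarrow> (nat \<Rightarrow> 'k::field) topology" where
  "zariski_topology d = topology (zariski_open d)"

definition holds_for_general_linear_form ::
  "nat \<Rightarrow> (((nat \<Rightarrow>\<^sub>0 nat) \<Rightarrow>\<^sub>0 'k::field) \<Rightarrow> bool) \<Rightarrow> bool" where
  "holds_for_general_linear_form d P \<longleftrightarrow>
    (\<exists>U. openin (zariski_topology d) U \<and>
         Abstract_Topology.closure_of (zariski_topology d) U = topspace (zariski_topology d) \<and>
         (\<forall>\<alpha>\<in>U. P (linear_form d \<alpha>)))"

text \<open>The Zariski open sets do form a topology, so that \<^const>\<open>zariski_topology\<close> has them as its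
  open sets.\<close>

lemma monom_eval_superset:
  assumes "finite A" "Poly_Mapping.keys m \<subseteq> A"
  shows "monom_eval \<alpha> m = (\<Prod>i\<in>A. \<alpha> i ^ Poly_Mapping.lookup m i)"
  unfolding monom_eval_def
  by (rule prod.mono_neutral_left) (use assms in \<open>auto simp: in_keys_iff\<close>)

lemma monom_eval_add: "monom_eval \<alpha> (a + b) = monom_eval \<alpha> a * monom_eval \<alpha> b"
proof -
  let ?A = "Poly_Mapping.keys a \<union> Poly_Mapping.keys b"
  have "Poly_Mapping.keys (a + b) \<subseteq> ?A" by (rule Poly_Mapping.keys_add)
  then show ?thesis
    by (simp add: monom_eval_superset[of ?A] lookup_add power_add prod.distrib)
qed

lemma poly_eval_superset:
  assumes "finite A" "Poly_Mapping.keys p \<subseteq> A"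
  shows "poly_eval \<alpha> p = (\<Sum>m\<in>A. Poly_Mapping.lookup p m * monom_eval \<alpha> m)"
  unfolding poly_eval_def
  by (rule sum.mono_neutral_left) (use assms in \<open>auto simp: in_keys_iff\<close>)

lemma poly_eval_add: "poly_eval \<alpha> (p + q) = poly_eval \<alpha> p + poly_eval \<alpha> q"
proof -
  let ?A = "Poly_Mapping.keys p \<union> Poly_Mapping.keys q"
  have "Poly_Mapping.keys (p + q) \<subseteq> ?A" by (rule Poly_Mapping.keys_add)
  then show ?thesis
    by (simp add: poly_eval_superset[of ?A] lookup_add distrib_right sum.distrib)
qed

lemma poly_eval_0 [simp]: "poly_eval \<alpha> 0 = 0"
  by (simp add: poly_eval_def)

lemma poly_eval_single: "poly_eval \<alpha> (Poly_Mapping.single m c) = c * monom_eval \<alpha> m"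
  by (subst poly_eval_superset[of "{m}"]) auto

lemma poly_eval_1 [simp]: "poly_eval \<alpha> 1 = 1"
  by (simp flip: single_one add: poly_eval_single monom_eval_def)

lemma poly_eval_sum: "poly_eval \<alpha> (sum f A) = (\<Sum>x\<in>A. poly_eval \<alpha> (f x))"
  by (induction A rule: infinite_finite_induct) (auto simp: poly_eval_add)

lemma poly_mapping_sum_single: "p = (\<Sum>m\<in>Poly_Mapping.keys p. Poly_Mapping.single m (Poly_Mapping.lookup p m))"
  by (rule poly_mapping_eqI)
     (auto simp: lookup_sum lookup_single when_def in_keys_iff)

lemma poly_eval_mult: "poly_eval \<alpha> (p * q) = poly_eval \<alpha> p * poly_eval \<alpha> q"
proof -
  have "p * q = (\<Sum>a\<in>Poly_Mapping.keys p. \<Sum>b\<in>Poly_Mapping.keys q.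
          Poly_Mapping.single (a + b) (Poly_Mapping.lookup p a * Poly_Mapping.lookup q b))"
    using arg_cong2[OF poly_mapping_sum_single[of p] poly_mapping_sum_single[of q], of "(*)"]
    by (simp only: sum_product mult_single)
  then have "poly_eval \<alpha> (p * q) = (\<Sum>a\<in>Poly_Mapping.keys p. \<Sum>b\<in>Poly_Mapping.keys q.
          (Poly_Mapping.lookup p a * monom_eval \<alpha> a) * (Poly_Mapping.lookup q b * monom_eval \<alpha> b))"
    by (simp add: poly_eval_sum poly_eval_single monom_eval_add mult_ac)
  then show ?thesis
    by (simp add: poly_eval_def sum_product)
qed

lemma istopology_zariski_open:
  "istopology (zariski_open d :: (nat \<Rightarrow> 'k::field) set \<Rightarrow> bool)"
  unfolding istopology_def
proof (intro conjI allI impI)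
  fix S T :: "(nat \<Rightarrow> 'k) set"
  assume "zariski_open d S" "zariski_open d T"
  then obtain F G where F: "F \<subseteq> carrier (polynomial_ring d)" "S = affine_space d - zero_locus d F"
    and G: "G \<subseteq> carrier (polynomial_ring d)" "T = affine_space d - zero_locus d G"
    unfolding zariski_open_def by blast
  let ?H = "{f * g |f g. f \<in> F \<and> g \<in> G}"
  have "?H \<subseteq> carrier (polynomial_ring d)"
    using F(1) G(1) polynomial_mult_closed by blast
  moreover have "S \<inter> T = affine_space d - zero_locus d ?H"
  proof (rule Set.set_eqI)
    fix \<alpha> :: "nat \<Rightarrow> 'k"
    have "(\<forall>h\<in>?H. poly_eval \<alpha> h = 0) \<longleftrightarrow>
        (\<forall>f\<in>F. \<forall>g\<in>G. poly_eval \<alpha> f = 0 \<or> poly_eval \<alpha> g = 0)"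
    proof -
      have "poly_eval \<alpha> (f * g) = 0 \<longleftrightarrow> poly_eval \<alpha> f = 0 \<or> poly_eval \<alpha> g = 0" for f g
        by (simp add: poly_eval_mult)
      then show ?thesis by blast
    qed
    then show "\<alpha> \<in> S \<inter> T \<longleftrightarrow> \<alpha> \<in> affine_space d - zero_locus d ?H"
      unfolding F(2) G(2) zero_locus_def by blast
  qed
  ultimately show "zariski_open d (S \<inter> T)"
    unfolding zariski_open_def by blast
next
  fix \<K> :: "(nat \<Rightarrow> 'k) set set"
  assume "\<forall>K\<in>\<K>. zariski_open d K"
  then obtain F where F: "\<And>K. K \<in> \<K> \<Longrightarrow> F K \<subseteq> carrier (polynomial_ring d)"
    "\<And>K. K \<in> \<K> \<Longrightarrow> K = affine_space d - zero_locus d (F K)"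
    unfolding zariski_open_def by metis
  have "\<Union>\<K> = affine_space d - zero_locus d (\<Union>(F ` \<K>))"
    using F(2) unfolding zero_locus_def by blast
  moreover have "\<Union>(F ` \<K>) \<subseteq> carrier (polynomial_ring d)"
    using F(1) by blast
  ultimately show "zariski_open d (\<Union>\<K>)"
    unfolding zariski_open_def by blast
qed

lemma openin_zariski_topology: "openin (zariski_topology d) U \<longleftrightarrow> zariski_open d U"
  by (simp add: zariski_topology_def topology_inverse' istopology_zariski_open)

lemma topspace_zariski_topology: "topspace (zariski_topology d) = affine_space d"
proof -
  have "zariski_open d (affine_space d)"
    unfolding zariski_open_def by (intro exI[of _ "{1}"]) (auto simp: zero_locus_def)
  moreover have "U \<subseteq> affine_space d" if "zariski_open d U" for U
    using that unfolding zariski_open_def by blast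
  ultimately show ?thesis
    unfolding topspace_def openin_zariski_topology by blast
qed

end

theory Submission
  imports Defs "HOL-Computational_Algebra.Polynomial"
begin

text \<open>Take the linear form \<open>a\<close> with all coefficients \<open>\<alpha>\<^sub>1, \<dots>, \<alpha>\<^sub>d\<close> nonzero; over an infinite field
  such \<open>\<alpha>\<close> form a dense open set (\<open>nonzero_coordinates_dense\<close>). Let \<open>m\<close> be the ideal of all the
  variables. The proof exhibits \<open>I + (a)\<close> as an intersection of ideals containing \<open>a\<close> that are
  visibly integrally closed modulo \<open>a\<close>. It is \<open>\<Inter>\<^sub>i (p\<^sub>i + (a))\<close>, except when there are exactly two
  components, both nonzero, which together involve every variable; then \<open>m\<^sup>2 + (a)\<close> has to be
  added to the intersection.

  For the intersection formula, let \<open>f\<close> be congruent to \<open>a g\<^sub>i\<close> modulo \<open>p\<^sub>i\<close> for every \<open>i\<close>. A polynomial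
  \<open>G\<close> congruent to every \<open>g\<^sub>i\<close> modulo \<open>p\<^sub>i\<close> gives \<open>f - a G \<in> I\<close>. As the \<open>p\<^sub>i\<close> are monomial ideals, such
  a \<open>G\<close> can be assembled monomial by monomial as soon as \<open>g\<^sub>i\<close> and \<open>g\<^sub>j\<close> agree modulo \<open>p\<^sub>i + p\<^sub>j\<close>
  (\<open>glue_along_monomials\<close>). Now \<open>a (g\<^sub>i - g\<^sub>j)\<close> lies in the prime ideal \<open>p\<^sub>i + p\<^sub>j\<close>, so agreement is
  automatic unless \<open>a\<close> itself lies there, which happens only if \<open>p\<^sub>i + p\<^sub>j = m\<close>
  (\<open>glue_when_no_cover\<close>). In that case either some component \<open>p\<^sub>k\<close> is generated by no variables, so
  that \<open>I = p\<^sub>k = 0\<close> and \<open>g\<^sub>k\<close> serves for all, or \<open>p\<^sub>i\<close> and \<open>p\<^sub>j\<close> are the only components, and \<open>g\<^sub>i\<close> and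
  \<open>g\<^sub>j\<close> have to have the same constant coefficient. They do if the linear part of \<open>f\<close> is a multiple of
  \<open>a\<close> (\<open>glue_two_covering\<close>).

  That an integral element lies in these ideals is tested by homomorphisms into integral domains
  killing \<open>a\<close>. If such a homomorphism maps \<open>I\<close> into a principal ideal \<open>(b)\<close>, then it maps elements
  integral over the image of \<open>I\<close> to elements integral over \<open>(b)\<close> (\<open>integral_closure_quotient_hom\<close>). A
  linear substitution with kernel \<open>p\<^sub>i + (a)\<close> and \<open>b = 0\<close> deals with the prime ideals
  (\<open>linear_section_of_var_ideal\<close>). For \<open>m\<^sup>2 + (a)\<close>, restrict to the lines through the origin in the
  hyperplane \<open>a = 0\<close>: \<open>I\<close> becomes divisible by \<open>X\<^sup>2\<close>, hence so does every integral element, so its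
  linear term vanishes on the hyperplane and is a multiple of \<open>a\<close>.\<close>

section \<open>Substitution homomorphisms\<close>

abbreviation "mkeys \<equiv> Poly_Mapping.keys"
abbreviation "mlookup \<equiv> Poly_Mapping.lookup"

type_synonym 'k mpoly = "(nat \<Rightarrow>\<^sub>0 nat) \<Rightarrow>\<^sub>0 'k"

locale coefficient_hom =
  fixes h :: "'k::field \<Rightarrow> 'b::comm_ring_1"
  assumes hom_one: "h 1 = 1"
    and hom_add: "h (x + y) = h x + h y"
    and hom_mult: "h (x * y) = h x * h y"

definition monom_subst :: "(nat \<Rightarrow> 'b::comm_ring_1) \<Rightarrow> (nat \<Rightarrow>\<^sub>0 nat) \<Rightarrow> 'b" where
  "monom_subst \<sigma> m = (\<Prod>i\<in>mkeys m. \<sigma> i ^ mlookup m i)"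

definition subst :: "('k::field \<Rightarrow> 'b::comm_ring_1) \<Rightarrow> (nat \<Rightarrow> 'b) \<Rightarrow> 'k mpoly \<Rightarrow> 'b" where
  "subst h \<sigma> p = (\<Sum>m\<in>mkeys p. h (mlookup p m) * monom_subst \<sigma> m)"

lemma monom_subst_superset:
  assumes "finite A" "mkeys m \<subseteq> A"
  shows "monom_subst \<sigma> m = (\<Prod>i\<in>A. \<sigma> i ^ mlookup m i)"
  unfolding monom_subst_def
  by (rule prod.mono_neutral_left) (use assms in \<open>auto simp: in_keys_iff\<close>)

lemma monom_subst_add: "monom_subst \<sigma> (a + b) = monom_subst \<sigma> a * monom_subst \<sigma> b"
proof -
  let ?A = "mkeys a \<union> mkeys b"
  have "mkeys (a + b) \<subseteq> ?A" by (rule Poly_Mapping.keys_add)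
  then show ?thesis
    by (simp add: monom_subst_superset[of ?A] lookup_add power_add prod.distrib)
qed

lemma monom_subst_eq_0:
  assumes "\<And>v. v \<in> V \<Longrightarrow> \<sigma> v = 0" "mkeys m \<inter> V \<noteq> {}"
  shows "monom_subst \<sigma> m = 0"
proof -
  obtain v where "v \<in> mkeys m" "v \<in> V" using assms(2) by auto
  then have "\<sigma> v ^ mlookup m v = 0"
    using assms(1) by (auto simp: in_keys_iff power_0_left)
  then show ?thesis
    using \<open>v \<in> mkeys m\<close> prod_zero[of "mkeys m" "\<lambda>i. \<sigma> i ^ mlookup m i"]
    unfolding monom_subst_def by auto
qed

context coefficient_hom
begin

lemma hom_zero [simp]: "h 0 = 0"
  using hom_add[of 0 0] by simp

lemma subst_superset:
  assumes "finite A" "mkeys p \<subseteq> A"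
  shows "subst h \<sigma> p = (\<Sum>m\<in>A. h (mlookup p m) * monom_subst \<sigma> m)"
  unfolding subst_def
  by (rule sum.mono_neutral_left) (use assms in \<open>auto simp: in_keys_iff\<close>)

lemma subst_add: "subst h \<sigma> (p + q) = subst h \<sigma> p + subst h \<sigma> q"
proof -
  let ?A = "mkeys p \<union> mkeys q"
  have "mkeys (p + q) \<subseteq> ?A" by (rule Poly_Mapping.keys_add)
  then show ?thesis
    by (simp add: subst_superset[of ?A] lookup_add distrib_right sum.distrib hom_add)
qed

lemma subst_0 [simp]: "subst h \<sigma> 0 = 0"
  by (simp add: subst_def)

lemma subst_single: "subst h \<sigma> (Poly_Mapping.single m c) = h c * monom_subst \<sigma> m"
  by (subst subst_superset[of "{m}"]) auto

lemma subst_Const [simp]: "subst h \<sigma> (Const c) = h c"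
  by (simp add: Const_def subst_single monom_subst_def)

lemma subst_1 [simp]: "subst h \<sigma> 1 = 1"
  using subst_Const[of \<sigma> 1] by (simp add: Const_def hom_one)

lemma subst_Var [simp]: "subst h \<sigma> (Var i) = \<sigma> i"
  by (simp add: Var_def subst_single monom_subst_def hom_one)

lemma subst_sum: "subst h \<sigma> (sum f A) = (\<Sum>x\<in>A. subst h \<sigma> (f x))"
  by (induction A rule: infinite_finite_induct) (auto simp: subst_add)

lemma subst_mult: "subst h \<sigma> (p * q) = subst h \<sigma> p * subst h \<sigma> q"
proof -
  have "p * q = (\<Sum>a\<in>mkeys p. \<Sum>b\<in>mkeys q. Poly_Mapping.single (a + b) (mlookup p a * mlookup q b))"
    using arg_cong2[OF poly_mapping_sum_single[of p] poly_mapping_sum_single[of q], of "(*)"]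
    by (simp only: sum_product mult_single)
  then have "subst h \<sigma> (p * q) = (\<Sum>a\<in>mkeys p. \<Sum>b\<in>mkeys q.
      (h (mlookup p a) * monom_subst \<sigma> a) * (h (mlookup q b) * monom_subst \<sigma> b))"
    by (simp add: subst_sum subst_single monom_subst_add hom_mult mult_ac)
  then show ?thesis
    by (simp add: subst_def sum_product)
qed

lemma subst_diff: "subst h \<sigma> (p - q) = subst h \<sigma> p - subst h \<sigma> q"
  using subst_add[of \<sigma> "p - q" q] by simp

lemma subst_linear_form:
  "subst h \<sigma> (linear_form d \<alpha>) = (\<Sum>i=1..d. h (\<alpha> i) * \<sigma> i)"
  by (simp add: linear_form_def subst_sum subst_mult)

end

interpretation Const_hom: coefficient_hom "Const :: 'k::field \<Rightarrow> 'k mpoly"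
  by unfold_locales (simp_all add: Const_def single_add mult_single)

interpretation const_poly_hom: coefficient_hom "\<lambda>c :: 'k::field. [:c:]"
  by unfold_locales (auto simp: one_pCons)

lemma prod_Var_power:
  assumes "finite A"
  shows "(\<Prod>i\<in>A. Var i ^ e i) = (Poly_Mapping.single (\<Sum>i\<in>A. Poly_Mapping.single i (e i)) 1 :: 'k::field mpoly)"
  using assms
proof (induction A rule: finite_induct)
  case (insert i A)
  have "Var i ^ e = (Poly_Mapping.single (Poly_Mapping.single i e) 1 :: 'k mpoly)" for e
    by (induction e) (simp_all add: Var_def mult_single single_add [symmetric])
  then show ?case using insert by (simp add: mult_single)
qed simp

lemma monom_subst_Var: "monom_subst Var m = (Poly_Mapping.single m 1 :: 'k::field mpoly)"
  by (simp add: monom_subst_def prod_Var_power flip: poly_mapping_sum_single)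

text \<open>Constants and variables generate the polynomial ring, so identities between ring
  homomorphisms need only be checked on them.\<close>

lemma mpoly_induct [case_names Const Var add mult]:
  fixes p :: "'k::field mpoly"
  assumes C: "\<And>c. P (Const c)" and V: "\<And>i. P (Var i)"
    and A: "\<And>p q. P p \<Longrightarrow> P q \<Longrightarrow> P (p + q)" and M: "\<And>p q. P p \<Longrightarrow> P q \<Longrightarrow> P (p * q)"
  shows "P p"
proof -
  have 1: "P 1" using C[of 1] by (simp add: Const_def)
  have 0: "P 0" using C[of 0] by (simp add: Const_def)
  have pow: "P (Var i ^ e)" for i e
    by (induction e) (auto intro: 1 V M)
  have prd: "P (\<Prod>i\<in>B. Var i ^ e i)" for B e
    by (induction B rule: infinite_finite_induct) (auto intro: 1 M pow)
  have "P (Const c * monom_subst Var m)" for c m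
    unfolding monom_subst_def by (intro M C prd)
  moreover have "Const c * monom_subst Var m = Poly_Mapping.single m c" for c :: 'k and m
    by (simp add: monom_subst_Var Const_def mult_single)
  ultimately have s: "P (Poly_Mapping.single m c)" for m c by metis
  have "P (\<Sum>m\<in>B. Poly_Mapping.single m (mlookup p m))" for B
    by (induction B rule: infinite_finite_induct) (auto intro: 0 A s)
  then show ?thesis using poly_mapping_sum_single[of p] by metis
qed

section \<open>Ideals generated by variables\<close>

text \<open>The ideals \<open>var_ideal W\<close> and the homomorphisms \<open>kill_vars W\<close> live in the polynomial ring in all
  the variables, whose elements fill their type, so that no carrier has to be carried along. The
  passage to finitely many variables is \<^term>\<open>kill_vars (- {1..d})\<close>.\<close>

definition var_ideal :: "nat set \<Rightarrow> 'k::field mpoly set" where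
  "var_ideal W = {f. \<forall>m\<in>mkeys f. mkeys m \<inter> W \<noteq> {}}"

definition kill_vars :: "nat set \<Rightarrow> 'k::field mpoly \<Rightarrow> 'k mpoly" where
  "kill_vars W = subst Const (\<lambda>v. if v \<in> W then 0 else Var v)"

lemma kill_vars_simps [simp]:
  "kill_vars W 0 = 0"
  "kill_vars W (f + g) = kill_vars W f + kill_vars W g"
  "kill_vars W (f - g) = kill_vars W f - kill_vars W g"
  "kill_vars W (f * g) = kill_vars W f * kill_vars W g"
  by (simp_all add: kill_vars_def Const_hom.subst_add Const_hom.subst_diff Const_hom.subst_mult)

lemma lookup_kill_vars:
  "mlookup (kill_vars W f) u = (if mkeys u \<inter> W = {} then mlookup f u else 0)"
proof -
  have *: "monom_subst (\<lambda>v. if v \<in> W then 0 else Var v) m =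
      (if mkeys m \<inter> W = {} then Poly_Mapping.single m 1 else 0 :: 'a mpoly)" for m
  proof (cases "mkeys m \<inter> W = {}")
    case True
    then have "monom_subst (\<lambda>v. if v \<in> W then 0 else Var v) m = (monom_subst Var m :: 'a mpoly)"
      unfolding monom_subst_def by (intro prod.cong) auto
    then show ?thesis using True by (simp add: monom_subst_Var)
  next
    case False
    then show ?thesis
      using monom_subst_eq_0[of W "\<lambda>v. if v \<in> W then 0 else Var v" m] by simp
  qed
  have "kill_vars W f = (\<Sum>m\<in>mkeys f. if mkeys m \<inter> W = {} then Poly_Mapping.single m (mlookup f m) else 0)"
    unfolding kill_vars_def subst_def *
    by (intro sum.cong) (auto simp: Const_def mult_single)
  then have "mlookup (kill_vars W f) u =
      (\<Sum>m\<in>mkeys f. mlookup (if mkeys m \<inter> W = {} then Poly_Mapping.single m (mlookup f m) else 0) u)"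
    by (simp only: lookup_sum)
  also have "\<dots> =
      (\<Sum>m\<in>mkeys f. if m = u then (if mkeys u \<inter> W = {} then mlookup f u else 0) else 0)"
    by (intro sum.cong) (auto simp: lookup_single when_def)
  finally show ?thesis by (simp add: in_keys_iff sum.delta)
qed

lemma var_ideal_iff_kill: "f \<in> var_ideal W \<longleftrightarrow> kill_vars W f = 0"
  by (auto simp: var_ideal_def poly_mapping_eq_iff fun_eq_iff lookup_kill_vars in_keys_iff)

lemma var_ideal_closed:
  "0 \<in> var_ideal W"
  "f \<in> var_ideal W \<Longrightarrow> g \<in> var_ideal W \<Longrightarrow> f + g \<in> var_ideal W"
  "f \<in> var_ideal W \<Longrightarrow> g \<in> var_ideal W \<Longrightarrow> f - g \<in> var_ideal W"
  "f \<in> var_ideal W \<Longrightarrow> f * g \<in> var_ideal W"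
  "f \<in> var_ideal W \<Longrightarrow> g * f \<in> var_ideal W"
  by (simp_all add: var_ideal_iff_kill)

text \<open>The kernel of a homomorphism into an integral domain is prime.\<close>

lemma var_ideal_prime: "f * g \<in> var_ideal W \<longleftrightarrow> f \<in> var_ideal W \<or> g \<in> var_ideal W"
  by (simp add: var_ideal_iff_kill)

lemma var_ideal_sum: "(\<And>x. x \<in> A \<Longrightarrow> f x \<in> var_ideal W) \<Longrightarrow> sum f A \<in> var_ideal W"
  by (induction A rule: infinite_finite_induct) (auto intro: var_ideal_closed)

lemma var_ideal_mono: "W \<subseteq> W' \<Longrightarrow> var_ideal W \<subseteq> var_ideal W'"
  unfolding var_ideal_def by blast

lemma Var_in_var_ideal [simp]: "Var i \<in> var_ideal W \<longleftrightarrow> i \<in> W"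
  by (simp add: var_ideal_def Var_def)

lemma (in coefficient_hom) subst_var_ideal:
  assumes "f \<in> var_ideal W" "\<And>v. v \<in> W \<Longrightarrow> \<sigma> v = 0"
  shows "subst h \<sigma> f = 0"
proof -
  have "monom_subst \<sigma> m = 0" if "m \<in> mkeys f" for m
    using assms that by (intro monom_subst_eq_0[of W]) (auto simp: var_ideal_def)
  then show ?thesis by (simp add: subst_def)
qed

lemma linear_form_in_var_ideal:
  fixes \<alpha> :: "nat \<Rightarrow> 'k::field"
  assumes "\<And>i. i \<in> {1..d} \<Longrightarrow> \<alpha> i \<noteq> 0" "linear_form d \<alpha> \<in> var_ideal W"
  shows "{1..d} \<subseteq> W"
proof
  fix j assume j: "j \<in> {1..d}"
  show "j \<in> W"
  proof (rule ccontr)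
    assume "j \<notin> W"
    then have "0 = subst (\<lambda>c. [:c:]) (\<lambda>v. if v = j then 1 else 0) (linear_form d \<alpha>)"
      using assms(2) by (subst const_poly_hom.subst_var_ideal[of _ W]) auto
    also have "\<dots> = [:\<alpha> j:]"
      using j by (simp add: const_poly_hom.subst_linear_form if_distrib cong: if_cong)
    finally show False using assms(1)[OF j] by simp
  qed
qed

text \<open>The ideal \<open>p + (a)\<close>, with \<open>p\<close> generated by the variables in \<open>V\<close> and \<open>a\<close> the linear form, is the
  kernel of a substitution into an integral domain: send the variables in \<open>V\<close> to zero and, if some
  variable outside \<open>V\<close> is left, solve \<open>a = 0\<close> for that variable. Every polynomial is congruent to its
  image modulo \<open>p + (a)\<close>, because this is so for the variables.\<close>

lemma linear_section_of_var_ideal: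
  fixes \<alpha> :: "nat \<Rightarrow> 'k::field"
  assumes nz: "\<And>i. i \<in> {1..d} \<Longrightarrow> \<alpha> i \<noteq> 0"
  obtains \<sigma> :: "nat \<Rightarrow> 'k mpoly"
  where "subst Const \<sigma> (linear_form d \<alpha>) = 0" "\<And>v. v \<in> V \<Longrightarrow> \<sigma> v = 0"
    "\<And>f. \<exists>g. f - subst Const \<sigma> f - linear_form d \<alpha> * g \<in> var_ideal V"
proof -
  let ?a = "linear_form d \<alpha>"
  have ext: "\<exists>g. f - subst Const \<sigma> f - ?a * g \<in> var_ideal V"
    if var: "\<And>v. \<exists>g. Var v - \<sigma> v - ?a * g \<in> var_ideal V" for \<sigma> f
  proof (induction f rule: mpoly_induct)
    case (Const c)
    show ?case by (rule exI[of _ 0]) (simp add: var_ideal_closed)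
  next
    case (Var i)
    then show ?case using var by simp
  next
    case (add p q)
    then obtain g g' where "p - subst Const \<sigma> p - ?a * g \<in> var_ideal V"
      "q - subst Const \<sigma> q - ?a * g' \<in> var_ideal V" by blast
    from var_ideal_closed(2)[OF this] show ?case
      by (intro exI[of _ "g + g'"]) (simp add: Const_hom.subst_add algebra_simps)
  next
    case (mult p q)
    then obtain g g' where "p - subst Const \<sigma> p - ?a * g \<in> var_ideal V"
      "q - subst Const \<sigma> q - ?a * g' \<in> var_ideal V" by blast
    then have "(p - subst Const \<sigma> p - ?a * g) * q
        + subst Const \<sigma> p * (q - subst Const \<sigma> q - ?a * g') \<in> var_ideal V"
      by (rule var_ideal_closed(2)[OF var_ideal_closed(4) var_ideal_closed(5)])
    moreover have "(p - subst Const \<sigma> p - ?a * g) * q + subst Const \<sigma> p * (q - subst Const \<sigma> q - ?a * g')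
        = p * q - subst Const \<sigma> (p * q) - ?a * (g * q + subst Const \<sigma> p * g')"
      by (simp add: Const_hom.subst_mult algebra_simps)
    ultimately show ?case by metis
  qed
  show thesis
  proof (cases "{1..d} \<subseteq> V")
    case True
    let ?s = "\<lambda>v. if v \<in> V then 0 else Var v :: 'k mpoly"
    have "subst Const ?s ?a = 0"
      using True by (auto simp: Const_hom.subst_linear_form intro!: sum.neutral)
    moreover have "\<exists>g. Var v - ?s v - ?a * g \<in> var_ideal V" for v
      by (rule exI[of _ 0]) (simp add: var_ideal_closed)
    ultimately show thesis using that[of ?s] ext[of ?s] by auto
  next
    case False
    then obtain j where j: "j \<in> {1..d}" "j \<notin> V" by blast
    define r where "r = (\<Sum>i\<in>{1..d} - {j}. Const (\<alpha> i) * (if i \<in> V then 0 else Var i :: 'k mpoly))"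
    define \<sigma> where "\<sigma> v = (if v \<in> V then 0 else if v = j then - (Const (1 / \<alpha> j) * r) else Var v)" for v
    have inv: "Const (\<alpha> j) * Const (1 / \<alpha> j) = (1 :: 'k mpoly)"
      using nz[OF j(1)] by (simp add: Const_def mult_single)
    have "(\<Sum>i\<in>{1..d} - {j}. Const (\<alpha> i) * \<sigma> i) = r"
      unfolding r_def \<sigma>_def by (intro sum.cong) auto
    then have "subst Const \<sigma> ?a = Const (\<alpha> j) * \<sigma> j + r"
      using sum.remove[OF _ j(1), of "\<lambda>i. Const (\<alpha> i) * \<sigma> i"]
      by (simp add: Const_hom.subst_linear_form)
    also have "\<dots> = 0" using j inv by (simp add: \<sigma>_def flip: mult.assoc)
    finally have 1: "subst Const \<sigma> ?a = 0" .
    have "\<exists>g. Var v - \<sigma> v - ?a * g \<in> var_ideal V" for v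
    proof (cases "v = j")
      case True
      have "?a - Const (\<alpha> j) * Var j - r =
          (\<Sum>i\<in>{1..d} - {j}. Const (\<alpha> i) * (if i \<in> V then Var i else 0 :: 'k mpoly))"
      proof -
        have "?a - Const (\<alpha> j) * Var j = (\<Sum>i\<in>{1..d} - {j}. Const (\<alpha> i) * Var i)"
          using sum.remove[OF _ j(1), of "\<lambda>i. Const (\<alpha> i) * Var i :: 'k mpoly"]
          by (simp add: linear_form_def)
        then show ?thesis
          by (simp only: r_def flip: sum_subtractf) (rule sum.cong, auto)
      qed
      also have "\<dots> \<in> var_ideal V"
        by (intro var_ideal_sum var_ideal_closed) (auto simp: var_ideal_closed)
      finally have "- Const (1 / \<alpha> j) * (?a - Const (\<alpha> j) * Var j - r) \<in> var_ideal V"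
        by (rule var_ideal_closed)
      moreover have "- Const (1 / \<alpha> j) * (?a - Const (\<alpha> j) * Var j - r)
          = (Const (\<alpha> j) * Const (1 / \<alpha> j)) * Var j + Const (1 / \<alpha> j) * r - ?a * Const (1 / \<alpha> j)"
        by (simp add: algebra_simps)
      ultimately show ?thesis
        using j True by (intro exI[of _ "Const (1 / \<alpha> j)"]) (simp add: inv \<sigma>_def)
    next
      case False
      then show ?thesis by (intro exI[of _ 0]) (simp add: \<sigma>_def var_ideal_closed)
    qed
    then show thesis using that[of \<sigma>] ext[of \<sigma>] 1 by (auto simp: \<sigma>_def)
  qed
qed

section \<open>Gluing quotients along monomial ideals\<close>

text \<open>A Chinese remainder theorem for monomial ideals: the coefficient of a monomial \<open>u\<close> in \<open>G\<close> is
  prescribed by any \<open>g i\<close> with \<open>u\<close> outside \<^term>\<open>var_ideal (V i)\<close>, and pairwise compatibility makes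
  these prescriptions agree.\<close>

lemma glue_along_monomials:
  fixes g :: "'i \<Rightarrow> 'k::field mpoly" and V :: "'i \<Rightarrow> nat set"
  assumes "finite N"
    and compat: "\<And>i j u. i \<in> N \<Longrightarrow> j \<in> N \<Longrightarrow> i \<noteq> j \<Longrightarrow> mkeys u \<inter> (V i \<union> V j) = {} \<Longrightarrow>
      mlookup (g i) u = mlookup (g j) u"
  obtains G where "\<And>i. i \<in> N \<Longrightarrow> G - g i \<in> var_ideal (V i)"
proof -
  define pick where "pick (u :: nat \<Rightarrow>\<^sub>0 nat) = (SOME i :: 'i. i \<in> N \<and> mkeys u \<inter> V i = {})" for u
  define S where "S = {u \<in> (\<Union>i\<in>N. mkeys (g i)). \<exists>i\<in>N. mkeys u \<inter> V i = {}}"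
  define G where "G = (\<Sum>u\<in>S. Poly_Mapping.single u (mlookup (g (pick u)) u))"
  have "finite S" unfolding S_def using assms(1) by auto
  then have G: "mlookup G u = (if u \<in> S then mlookup (g (pick u)) u else 0)" for u
    by (simp add: G_def lookup_sum lookup_single when_def)
  have "G - g i \<in> var_ideal (V i)" if i: "i \<in> N" for i
  proof -
    have "mlookup G u = mlookup (g i) u" if u: "mkeys u \<inter> V i = {}" for u :: "nat \<Rightarrow>\<^sub>0 nat"
    proof -
      have "pick u \<in> N \<and> mkeys u \<inter> V (pick u) = {}"
        unfolding pick_def by (rule someI[of _ i]) (use i u in auto)
      then have "mlookup (g (pick u)) u = mlookup (g i) u"
        using compat[of "pick u" i u] i u by (cases "pick u = i") auto
      moreover have "mlookup (g i) u = 0" if "u \<notin> S"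
        using that i u unfolding S_def by (auto simp: in_keys_iff)
      ultimately show ?thesis using G by auto
    qed
    then show ?thesis by (auto simp: var_ideal_def in_keys_iff lookup_minus)
  qed
  then show thesis by (rule that)
qed

lemma glue_modulo_form:
  fixes f a :: "'k::field mpoly"
  assumes "finite N"
    and eq: "\<And>i. i \<in> N \<Longrightarrow> f - a * g i \<in> var_ideal (V i)"
    and compat: "\<And>i j u. i \<in> N \<Longrightarrow> j \<in> N \<Longrightarrow> i \<noteq> j \<Longrightarrow> mkeys u \<inter> (V i \<union> V j) = {} \<Longrightarrow>
      mlookup (g i) u = mlookup (g j) u"
  shows "\<exists>G. \<forall>i\<in>N. f - a * G \<in> var_ideal (V i)"
proof -
  obtain G where G: "\<And>i. i \<in> N \<Longrightarrow> G - g i \<in> var_ideal (V i)"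
    using glue_along_monomials[of N V g] assms by blast
  have "f - a * G \<in> var_ideal (V i)" if "i \<in> N" for i
  proof -
    have "(f - a * g i) - a * (G - g i) \<in> var_ideal (V i)"
      by (intro var_ideal_closed eq G that)
    then show ?thesis by (simp add: algebra_simps)
  qed
  then show ?thesis by blast
qed

text \<open>Compatibility comes for free where \<open>a\<close> can be cancelled modulo the prime ideal of
  \<open>V i \<union> V j\<close>.\<close>

lemma glue_when_no_cover:
  fixes f a :: "'k::field mpoly"
  assumes "finite N"
    and eq: "\<And>i. i \<in> N \<Longrightarrow> f - a * g i \<in> var_ideal (V i)"
    and nz: "\<And>i j. i \<in> N \<Longrightarrow> j \<in> N \<Longrightarrow> i \<noteq> j \<Longrightarrow> a \<notin> var_ideal (V i \<union> V j)"
  shows "\<exists>G. \<forall>i\<in>N. f - a * G \<in> var_ideal (V i)"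
proof (rule glue_modulo_form[OF assms(1) eq])
  fix i j and u :: "nat \<Rightarrow>\<^sub>0 nat" assume ij: "i \<in> N" "j \<in> N" "i \<noteq> j" and u: "mkeys u \<inter> (V i \<union> V j) = {}"
  have "f - a * g i \<in> var_ideal (V i \<union> V j)" "f - a * g j \<in> var_ideal (V i \<union> V j)"
    using eq[OF ij(1)] eq[OF ij(2)] var_ideal_mono[of "V i" "V i \<union> V j"]
      var_ideal_mono[of "V j" "V i \<union> V j"] by blast+
  from var_ideal_closed(3)[OF this(2,1)] have "a * (g i - g j) \<in> var_ideal (V i \<union> V j)"
    by (simp add: algebra_simps)
  with nz[OF ij] have "g i - g j \<in> var_ideal (V i \<union> V j)" by (simp add: var_ideal_prime)
  then have "u \<notin> mkeys (g i - g j)" using u by (auto simp: var_ideal_def)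
  then show "mlookup (g i) u = mlookup (g j) u" by (simp add: in_keys_iff lookup_minus)
qed auto

section \<open>Integral dependence on a principal ideal\<close>

definition integral_over_principal :: "'b::comm_ring_1 \<Rightarrow> 'b \<Rightarrow> bool" where
  "integral_over_principal b y \<longleftrightarrow>
    (\<exists>m\<ge>1. \<exists>c. y ^ m + (\<Sum>i=1..m. b ^ i * c i * y ^ (m - i)) = 0)"

lemma integral_over_zero:
  fixes y :: "'b::idom"
  assumes "integral_over_principal 0 y"
  shows "y = 0"
proof -
  obtain m c where m: "m \<ge> 1" "y ^ m + (\<Sum>i=1..m. 0 ^ i * c i * y ^ (m - i)) = 0"
    using assms unfolding integral_over_principal_def by blast
  have "(\<Sum>i=1..m. 0 ^ i * c i * y ^ (m - i)) = 0"
    by (rule sum.neutral) (auto simp: power_0_left)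
  with m show ?thesis by simp
qed

text \<open>The equation of integral dependence shows that \<open>X\<close> divides a power of \<open>y\<close>, hence \<open>y\<close>, and then
  the whole equation can be divided by \<open>X ^ m\<close>. Applied repeatedly this says that powers of \<open>(X)\<close> are
  integrally closed.\<close>

lemma integral_over_X_times:
  fixes y b :: "'k::field poly"
  assumes "integral_over_principal ([:0, 1:] * b) y"
  obtains z where "y = [:0, 1:] * z" "integral_over_principal b z"
proof -
  let ?X = "[:0, 1:] :: 'k poly"
  obtain m c where m: "m \<ge> 1" "y ^ m + (\<Sum>i=1..m. (?X * b) ^ i * c i * y ^ (m - i)) = 0"
    using assms unfolding integral_over_principal_def by blast
  have "poly (\<Sum>i=1..m. (?X * b) ^ i * c i * y ^ (m - i)) 0 = 0"
    unfolding poly_sum by (rule sum.neutral) (auto simp: power_0_left)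
  then have "poly y 0 ^ m = 0"
    using arg_cong[OF m(2), of "\<lambda>p. poly p 0"] by simp
  then have "poly y 0 = 0" by simp
  then obtain z where z: "y = ?X * z"
    using poly_eq_0_iff_dvd[of y 0] by (auto simp: dvd_def)
  have "(?X * b) ^ i * c i * y ^ (m - i) = ?X ^ m * (b ^ i * c i * z ^ (m - i))"
    if "i \<in> {1..m}" for i
  proof -
    have "?X ^ m = ?X ^ i * ?X ^ (m - i)" using that by (simp flip: power_add)
    then show ?thesis unfolding z power_mult_distrib by (simp only: mult_ac)
  qed
  then have "(\<Sum>i=1..m. (?X * b) ^ i * c i * y ^ (m - i)) = ?X ^ m * (\<Sum>i=1..m. b ^ i * c i * z ^ (m - i))"
    unfolding sum_distrib_left by (rule sum.cong[OF refl])
  then have "?X ^ m * (z ^ m + (\<Sum>i=1..m. b ^ i * c i * z ^ (m - i))) = 0"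
    using m(2) by (simp only: distrib_left z power_mult_distrib)
  then have "z ^ m + (\<Sum>i=1..m. b ^ i * c i * z ^ (m - i)) = 0" by simp
  then show thesis using that z m(1) unfolding integral_over_principal_def by blast
qed

lemma integral_over_X_squared:
  fixes y :: "'k::field poly"
  assumes "integral_over_principal ([:0, 1:] ^ 2) y"
  shows "[:0, 1:] ^ 2 dvd y"
proof -
  have "integral_over_principal ([:0, 1:] * ([:0, 1:] * 1)) y"
    using assms by (simp add: power2_eq_square)
  then obtain z where z: "y = [:0, 1:] * z" "integral_over_principal ([:0, 1:] * 1) z"
    by (rule integral_over_X_times)
  then obtain w where "z = [:0, 1:] * w" by (elim integral_over_X_times)
  with z have "y = [:0, 1:] ^ 2 * w" by (simp only: power2_eq_square mult.assoc)
  then show ?thesis by simp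
qed

lemma X_squared_dvd_iff:
  fixes p :: "'k::field poly"
  shows "[:0, 1:] ^ 2 dvd p \<longleftrightarrow> coeff p 0 = 0 \<and> coeff p 1 = 0"
proof -
  have "[:0, 1:] ^ 2 = (monom 1 2 :: 'k poly)"
    by (simp add: monom_altdef)
  then show ?thesis using monom_1_dvd_iff'[of 2 p] by (auto simp: less_2_cases_iff)
qed

text \<open>The coefficient of index \<open>i\<close> in the equation lies in the \<open>i\<close>-th power of \<open>J\<close>, whose image is
  divisible by \<open>b ^ i\<close>.\<close>

lemma integral_closure_hom:
  fixes S (structure) and \<psi> :: "'a \<Rightarrow> 'b::comm_ring_1"
  assumes S: "cring S" and J: "ideal J S"
    and one: "\<psi> \<one> = 1"
    and add: "\<And>x y. x \<in> carrier S \<Longrightarrow> y \<in> carrier S \<Longrightarrow> \<psi> (x \<oplus> y) = \<psi> x + \<psi> y"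
    and mult: "\<And>x y. x \<in> carrier S \<Longrightarrow> y \<in> carrier S \<Longrightarrow> \<psi> (x \<otimes> y) = \<psi> x * \<psi> y"
    and dvd: "\<And>x. x \<in> J \<Longrightarrow> b dvd \<psi> x"
    and y: "y \<in> integral_closure S J"
  shows "integral_over_principal b (\<psi> y)"
proof -
  interpret cring S by (rule S)
  interpret M: comm_monoid "ideals_set S" by (rule ideals_set_is_comm_monoid)
  have zero: "\<psi> \<zero> = 0" using add[of \<zero> \<zero>] by simp
  have pow: "\<psi> (x [^] n) = \<psi> x ^ n" if "x \<in> carrier S" for x and n :: nat
    using that by (induction n) (simp_all add: one mult mult.commute)
  have sum: "\<psi> (\<Oplus>i\<in>A. f i) = (\<Sum>i\<in>A. \<psi> (f i))" if "finite A" "f \<in> A \<rightarrow> carrier S" for A :: "nat set" and f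
    using that by (induction A rule: finite_induct) (auto simp: zero add)
  have Jc: "J \<in> carrier (ideals_set S)" using J by (simp add: ideals_set_def)
  have pid: "ideal (ideal_power S J i) S" for i
    using M.nat_pow_closed[OF Jc, of i] by (simp add: ideal_power_def ideals_set_def)
  have pdvd: "x \<in> ideal_power S J i \<Longrightarrow> b ^ i dvd \<psi> x" for x i
  proof (induction i arbitrary: x)
    case (Suc i)
    have "x \<in> ideal_prod S (ideal_power S J i) J"
      using Suc.prems by (simp add: ideal_power_def ideals_set_def)
    then show ?case
    proof (induction x rule: ideal_prod.induct)
      case (prod x z)
      have "\<psi> (x \<otimes> z) = \<psi> x * \<psi> z"
        using prod ideal.Icarr[OF pid] ideal.Icarr[OF J] by (intro mult) auto
      then show ?case
        using mult_dvd_mono[OF Suc.IH[OF prod(1)] dvd[OF prod(2)]] by (simp add: mult.commute)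
    next
      case (sum s t)
      then have "s \<in> carrier S" "t \<in> carrier S"
        using ideal_prod_in_carrier[OF pid J] by blast+
      with sum show ?case by (simp add: add)
    qed
  qed simp
  obtain m c where yS: "y \<in> carrier S" and m: "m \<ge> 1"
    and c: "\<And>i. i \<in> {1..m} \<Longrightarrow> c i \<in> ideal_power S J i"
    and eq: "y [^] (m::nat) \<oplus> (\<Oplus>i\<in>{1..m}. c i \<otimes> y [^] (m - i)) = \<zero>"
    using y unfolding integral_closure_def by blast
  have cS: "c i \<in> carrier S" if "i \<in> {1..m}" for i
    using ideal.Icarr[OF pid c[OF that]] .
  have "\<forall>i\<in>{1..m}. \<exists>e. \<psi> (c i) = b ^ i * e"
    using pdvd[OF c] by (auto simp: dvd_def)
  then obtain e where e: "\<And>i. i \<in> {1..m} \<Longrightarrow> \<psi> (c i) = b ^ i * e i" by metis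
  have "0 = \<psi> (y [^] m) + \<psi> (\<Oplus>i\<in>{1..m}. c i \<otimes> y [^] (m - i))"
    unfolding zero[symmetric] eq[symmetric]
    using yS cS by (intro add finsum_closed) auto
  also have "\<psi> (\<Oplus>i\<in>{1..m}. c i \<otimes> y [^] (m - i)) = (\<Sum>i=1..m. b ^ i * e i * \<psi> y ^ (m - i))"
    using yS cS by (subst sum) (auto intro!: sum.cong simp: mult pow e)
  finally show ?thesis
    using m yS unfolding integral_over_principal_def by (auto simp: pow)
qed

lemma integral_closure_quotient_hom:
  fixes R (structure) and \<psi> :: "'a \<Rightarrow> 'b::comm_ring_1"
  assumes R: "cring R" and A: "ideal A R" and J: "ideal J R"
    and one: "\<psi> \<one> = 1"
    and add: "\<And>x y. x \<in> carrier R \<Longrightarrow> y \<in> carrier R \<Longrightarrow> \<psi> (x \<oplus> y) = \<psi> x + \<psi> y"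
    and mult: "\<And>x y. x \<in> carrier R \<Longrightarrow> y \<in> carrier R \<Longrightarrow> \<psi> (x \<otimes> y) = \<psi> x * \<psi> y"
    and kernel: "\<And>x. x \<in> A \<Longrightarrow> \<psi> x = 0"
    and dvd: "\<And>x. x \<in> J \<Longrightarrow> b dvd \<psi> x"
    and f: "f \<in> carrier R" "A +> f \<in> integral_closure (R Quot A) ((+>) A ` J)"
  shows "integral_over_principal b (\<psi> f)"
proof -
  interpret cring R by (rule R)
  interpret A: ideal A R by (rule A)
  \<comment> \<open>The map induced on the quotient: its value on a coset may be read off at any representative.\<close>
  define \<Psi> where "\<Psi> X = \<psi> (SOME g. g \<in> X)" for X
  have \<Psi>: "\<Psi> (A +> g) = \<psi> g" if g: "g \<in> carrier R" for g
  proof -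
    have "(SOME x. x \<in> A +> g) \<in> A +> g"
      using A.a_rcos_self[OF g] by (rule someI)
    then obtain x where "x \<in> A" "(SOME x. x \<in> A +> g) = x \<oplus> g"
      unfolding a_r_coset_def' by auto
    then show ?thesis using g A.Icarr by (simp add: \<Psi>_def add kernel)
  qed
  interpret Q: cring "R Quot A" by (rule A.quotient_is_cring[OF R])
  have cosets: "\<exists>g\<in>carrier R. X = A +> g" if "X \<in> carrier (R Quot A)" for X
    using that by (auto simp: FactRing_def A_RCOSETS_def')
  have "integral_over_principal b (\<Psi> (A +> f))"
  proof (rule integral_closure_hom[OF Q.is_cring _ _ _ _ _ f(2)])
    show "ideal ((+>) A ` J) (R Quot A)"
      by (rule ring_ideal_imp_quot_ideal[OF A J])
    show "\<Psi> \<one>\<^bsub>R Quot A\<^esub> = 1"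
      by (simp add: FactRing_def \<Psi> one)
    fix X Y assume X: "X \<in> carrier (R Quot A)" and Y: "Y \<in> carrier (R Quot A)"
    obtain x y where xy: "x \<in> carrier R" "X = A +> x" "y \<in> carrier R" "Y = A +> y"
      using cosets[OF X] cosets[OF Y] by blast
    show "\<Psi> (X \<oplus>\<^bsub>R Quot A\<^esub> Y) = \<Psi> X + \<Psi> Y"
      using xy by (simp add: FactRing_def A.a_rcos_sum \<Psi> add)
    show "\<Psi> (X \<otimes>\<^bsub>R Quot A\<^esub> Y) = \<Psi> X * \<Psi> Y"
      using xy by (simp add: FactRing_def A.rcoset_mult_add \<Psi> mult)
  next
    fix X assume "X \<in> (+>) A ` J"
    then obtain x where "x \<in> J" "X = A +> x" by blast
    then show "b dvd \<Psi> X" using ideal.Icarr[OF J] by (simp add: \<Psi> dvd)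
  qed
  then show ?thesis by (simp add: \<Psi> f(1))
qed

text \<open>An element \<open>y\<close> of the ideal is a root of the polynomial \<open>Y - y\<close>.\<close>

lemma ideal_subset_integral_closure:
  fixes S (structure)
  assumes S: "cring S" and J: "ideal J S"
  shows "J \<subseteq> integral_closure S J"
proof
  fix y assume y: "y \<in> J"
  interpret cring S by (rule S)
  interpret M: comm_monoid "ideals_set S" by (rule ideals_set_is_comm_monoid)
  have yS: "y \<in> carrier S" using ideal.Icarr[OF J y] .
  have "J \<in> carrier (ideals_set S)" using J by (simp add: ideals_set_def)
  then have "ideal_power S J 1 = J" by (simp add: ideal_power_def)
  moreover have "\<ominus> y \<in> J" using additive_subgroup.a_inv_closed[OF ideal.axioms(1)[OF J] y] .
  moreover have "y [^] (1::nat) \<oplus> (\<Oplus>i\<in>{1..1}. \<ominus> y \<otimes> y [^] (1 - i :: nat)) = \<zero>"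
    using yS by (simp add: r_neg)
  ultimately have c: "\<forall>i\<in>{1..1}. \<ominus> y \<in> ideal_power S J i"
    and eq: "y [^] (1::nat) \<oplus> (\<Oplus>i\<in>{1..1}. \<ominus> y \<otimes> y [^] (1 - i :: nat)) = \<zero>"
    by simp_all
  show "y \<in> integral_closure S J"
    unfolding integral_closure_def mem_Collect_eq
    by (intro conjI yS exI[of _ "1::nat"] exI[of _ "\<lambda>_. \<ominus> y"] order_refl c eq)
qed

section \<open>Linear terms and restriction to lines\<close>

lemma poly_subst: "poly (subst (\<lambda>c. [:c:]) \<sigma> f) x = poly_eval (\<lambda>i. poly (\<sigma> i) x) f"
  by (simp add: subst_def poly_eval_def monom_subst_def monom_eval_def poly_sum poly_prod)

text \<open>Restricting \<open>f\<close> to the line through the origin in direction \<open>\<beta>\<close> gives a polynomial whose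
  coefficient of degree one is the linear part of \<open>f\<close> evaluated at \<open>\<beta>\<close>.\<close>

definition on_line :: "(nat \<Rightarrow> 'k::field) \<Rightarrow> 'k mpoly \<Rightarrow> 'k poly" where
  "on_line \<beta> = subst (\<lambda>c. [:c:]) (\<lambda>v. [:0, \<beta> v:])"

lemma coeff_0_on_line: "coeff (on_line \<beta> f) 0 = mlookup f 0"
proof -
  have *: "monom_eval (\<lambda>_. 0) m = (if m = 0 then 1 else 0 :: 'a)" for m
    by (auto simp: monom_eval_def power_0_left in_keys_iff)
  have "coeff (on_line \<beta> f) 0 = poly_eval (\<lambda>_. 0) f"
    unfolding on_line_def by (simp add: poly_subst flip: poly_0_coeff_0)
  also have "\<dots> = mlookup f 0"
    by (simp add: poly_eval_def * if_distrib in_keys_iff cong: if_cong)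
  finally show ?thesis .
qed

lemma coeff_1_on_line_mult:
  "coeff (on_line \<beta> (f * g)) 1 =
    mlookup f 0 * coeff (on_line \<beta> g) 1 + coeff (on_line \<beta> f) 1 * mlookup g 0"
  by (simp add: on_line_def const_poly_hom.subst_mult coeff_mult
      coeff_0_on_line[unfolded on_line_def])

lemma coeff_1_on_line_linear:
  "coeff (on_line (\<lambda>v. b * \<beta> v + c * \<gamma> v) f) 1 =
    b * coeff (on_line \<beta> f) 1 + c * coeff (on_line \<gamma> f) 1"
proof (induction f rule: mpoly_induct)
  case (add p q)
  then show ?case by (simp add: on_line_def const_poly_hom.subst_add algebra_simps)
next
  case (mult p q)
  then show ?case by (simp add: coeff_1_on_line_mult[unfolded One_nat_def] algebra_simps)
qed (simp_all add: on_line_def)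

abbreviation unit_vec :: "nat \<Rightarrow> nat \<Rightarrow> 'k::field" where
  "unit_vec j \<equiv> (\<lambda>v. if v = j then 1 else 0)"

lemma coeff_1_unit_vec_linear_form:
  assumes "j \<in> {1..d}"
  shows "coeff (on_line (unit_vec j) (linear_form d \<alpha>)) 1 = \<alpha> j"
proof -
  have "on_line (unit_vec j) (linear_form d \<alpha>) = (\<Sum>i=1..d. if i = j then [:0, \<alpha> j:] else 0)"
    unfolding on_line_def const_poly_hom.subst_linear_form by (intro sum.cong) auto
  then show ?thesis using assms by simp
qed

lemma lookup_0_linear_form: "mlookup (linear_form d \<alpha>) 0 = 0"
proof -
  have "mlookup (linear_form d \<alpha>) 0 = coeff (on_line (\<lambda>_. 0) (linear_form d \<alpha>)) 0"
    by (simp add: coeff_0_on_line)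
  then show ?thesis
    by (simp add: on_line_def const_poly_hom.subst_linear_form coeff_sum)
qed

lemma on_line_var_ideal:
  "f \<in> var_ideal W \<Longrightarrow> (\<And>v. v \<in> W \<Longrightarrow> \<beta> v = 0) \<Longrightarrow> on_line \<beta> f = 0"
  unfolding on_line_def by (erule const_poly_hom.subst_var_ideal) simp

text \<open>The directions \<open>tangent \<alpha> v w\<close> span the hyperplane on which the linear form with
  coefficients \<open>\<alpha>\<close> vanishes.\<close>

definition tangent :: "(nat \<Rightarrow> 'k::field) \<Rightarrow> nat \<Rightarrow> nat \<Rightarrow> nat \<Rightarrow> 'k" where
  "tangent \<alpha> v w = (\<lambda>x. \<alpha> w * unit_vec v x + - \<alpha> v * unit_vec w x)"

lemma coeff_1_on_line_tangent:
  "coeff (on_line (tangent \<alpha> v w) f) 1 =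
    \<alpha> w * coeff (on_line (unit_vec v) f) 1 - \<alpha> v * coeff (on_line (unit_vec w) f) 1"
  by (simp only: tangent_def coeff_1_on_line_linear) simp

lemma on_line_tangent_linear_form:
  assumes "v \<in> {1..d}" "w \<in> {1..d}"
  shows "on_line (tangent \<alpha> v w) (linear_form d \<alpha>) = 0"
proof -
  let ?\<beta> = "tangent \<alpha> v w"
  have "(\<Sum>x=1..d. \<alpha> x * ?\<beta> x) =
      \<alpha> w * (\<Sum>x=1..d. \<alpha> x * unit_vec v x) - \<alpha> v * (\<Sum>x=1..d. \<alpha> x * unit_vec w x)"
    unfolding tangent_def
    by (simp only: sum_distrib_left flip: sum_subtractf) (simp add: algebra_simps)
  also have "\<dots> = 0" using assms by (simp add: if_distrib cong: if_cong)
  finally have orthogonal: "(\<Sum>x=1..d. \<alpha> x * ?\<beta> x) = 0" .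
  have "on_line ?\<beta> (linear_form d \<alpha>) = (\<Sum>x=1..d. [:0, \<alpha> x * ?\<beta> x:])"
    unfolding on_line_def const_poly_hom.subst_linear_form by (intro sum.cong) auto
  also have "\<dots> = [:0, \<Sum>x=1..d. \<alpha> x * ?\<beta> x:]"
    by (rule poly_eqI) (simp add: coeff_sum coeff_pCons split: nat.split)
  finally show ?thesis using orthogonal by simp
qed

text \<open>Every monomial of \<open>q\<close> contains a variable of each of two disjoint sets, so \<open>q\<close> has no
  terms of degree at most one.\<close>

lemma X_squared_dvd_on_line_tangent:
  assumes "q \<in> var_ideal V" "q \<in> var_ideal W" "V \<inter> W = {}"
  shows "[:0, 1:] ^ 2 dvd on_line (tangent \<alpha> v w) q"
proof -
  have axis: "on_line (unit_vec x) q = 0" for x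
  proof (cases "x \<in> V")
    case True
    then show ?thesis using assms(3) by (intro on_line_var_ideal[OF assms(2)]) auto
  next
    case False
    then show ?thesis by (intro on_line_var_ideal[OF assms(1)]) auto
  qed
  have "coeff (on_line (tangent \<alpha> v w) q) 1 = 0"
    by (simp only: coeff_1_on_line_tangent axis) simp
  moreover have "coeff (on_line (tangent \<alpha> v w) q) 0 = 0"
    using coeff_0_on_line[of "unit_vec v" q] by (simp add: coeff_0_on_line axis)
  ultimately show ?thesis by (simp add: X_squared_dvd_iff)
qed

text \<open>A monomial outside both ideals involves no variable from \<open>1\<close> to \<open>d\<close>, so compatibility only
  concerns the constant coefficients of \<open>g i\<close> and \<open>g j\<close>. Subtracting a constant multiple of the form
  from \<open>f\<close> removes the linear part of \<open>f\<close>, as this part vanishes on the hyperplane where the form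
  vanishes. Afterwards both constant coefficients are zero: restricted to the axis of a variable \<open>v\<close>
  outside \<open>V k\<close>, the polynomial \<open>f\<close> becomes the form times \<open>g k\<close>, and its linear coefficient is
  \<open>\<alpha> v\<close> times the constant coefficient of \<open>g k\<close>.\<close>

lemma glue_two_covering:
  fixes f :: "'k::field mpoly" and i j :: "'i"
  assumes nz: "\<And>v. v \<in> {1..d} \<Longrightarrow> \<alpha> v \<noteq> 0"
    and V: "V i \<inter> V j = {}" "V i \<union> V j = {1..d}" "V i \<noteq> {}" "V j \<noteq> {}"
    and eq: "\<And>k. k \<in> {i, j} \<Longrightarrow> f - linear_form d \<alpha> * g k \<in> var_ideal (V k)"
    and g: "\<And>k. k \<in> {i, j} \<Longrightarrow> g k \<in> carrier (polynomial_ring d)"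
    and tangent: "\<And>v w. v \<in> {1..d} \<Longrightarrow> w \<in> {1..d} \<Longrightarrow>
      coeff (on_line (tangent \<alpha> v w) f) 1 = 0"
  shows "\<exists>G. \<forall>k\<in>{i, j}. f - linear_form d \<alpha> * G \<in> var_ideal (V k)"
proof -
  let ?a = "linear_form d \<alpha>"
  obtain w where w: "w \<in> {1..d}" using V by blast
  \<comment> \<open>The linear part of \<open>f\<close> is \<open>c\<close> times the form; the ratio can be read off at any variable.\<close>
  define c where "c = coeff (on_line (unit_vec w) f) 1 / \<alpha> w"
  define f' where "f' = f - ?a * Const c"
  define g' where "g' k = g k - Const c" for k
  have eq': "f' - ?a * g' k \<in> var_ideal (V k)" if "k \<in> {i, j}" for k
    using eq[OF that] by (simp add: f'_def g'_def algebra_simps)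
  have f': "coeff (on_line (unit_vec v) f') 1 = 0" if v: "v \<in> {1..d}" for v
  proof -
    have "\<alpha> w * coeff (on_line (unit_vec v) f) 1 = \<alpha> v * coeff (on_line (unit_vec w) f) 1"
      using tangent[OF v w] by (simp only: coeff_1_on_line_tangent) simp
    then have "coeff (on_line (unit_vec v) f) 1 = \<alpha> v * c"
      using nz[OF w] by (simp add: c_def field_simps)
    moreover have "coeff (on_line (unit_vec v) f') 1 = coeff (on_line (unit_vec v) f) 1 -
        coeff (on_line (unit_vec v) (?a * Const c)) 1"
      by (simp add: f'_def on_line_def const_poly_hom.subst_diff)
    moreover have "coeff (on_line (unit_vec v) (?a * Const c)) 1 = \<alpha> v * c"
      by (simp only: coeff_1_on_line_mult lookup_0_linear_form coeff_1_unit_vec_linear_form[OF v])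
        (simp add: Const_def)
    ultimately show ?thesis by simp
  qed
  have g'0: "mlookup (g' k) 0 = 0" if k: "k \<in> {i, j}" for k
  proof -
    obtain v where v: "v \<in> {1..d}" "v \<notin> V k" using V k by blast
    have "on_line (unit_vec v) (f' - ?a * g' k) = 0"
      by (rule on_line_var_ideal[OF eq'[OF k]]) (use v in auto)
    then have "0 = coeff (on_line (unit_vec v) f') 1 - coeff (on_line (unit_vec v) (?a * g' k)) 1"
      by (simp add: on_line_def const_poly_hom.subst_diff)
    also have "\<dots> = - (\<alpha> v * mlookup (g' k) 0)"
      by (simp only: coeff_1_on_line_mult lookup_0_linear_form coeff_1_unit_vec_linear_form[OF v(1)]
          f'[OF v(1)]) simp
    finally show ?thesis using nz[OF v(1)] by simp
  qed
  have g'_out: "mlookup (g' k) u = 0" if k: "k \<in> {i, j}" and u: "mkeys u \<inter> (V i \<union> V j) = {}" for k u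
  proof (cases "u = 0")
    case False
    then have "mkeys u \<noteq> {}" by simp
    then have "\<not> mkeys u \<subseteq> {1..d}" using u V by blast
    then have "u \<notin> mkeys (g k)" using g[OF k] by auto
    then show ?thesis using False
      by (simp add: g'_def lookup_minus in_keys_iff Const_def lookup_single)
  qed (use g'0 k in simp)
  have "\<exists>G. \<forall>k\<in>{i, j}. f' - ?a * G \<in> var_ideal (V k)"
  proof (rule glue_modulo_form[OF _ eq'])
    fix k l and u :: "nat \<Rightarrow>\<^sub>0 nat"
    assume kl: "k \<in> {i, j}" "l \<in> {i, j}" "k \<noteq> l" "mkeys u \<inter> (V k \<union> V l) = {}"
    then have "mkeys u \<inter> (V i \<union> V j) = {}" by auto
    then show "mlookup (g' k) u = mlookup (g' l) u" using g'_out kl by simp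
  qed auto
  then obtain G where "\<forall>k\<in>{i, j}. f' - ?a * G \<in> var_ideal (V k)" by blast
  then show ?thesis
    by (intro exI[of _ "G + Const c"]) (simp add: f'_def algebra_simps)
qed

text \<open>If no two of the variable sets exhaust the variables, then the form, having no vanishing
  coefficient, lies in none of the ideals \<^term>\<open>var_ideal (V i \<union> V j)\<close>. Otherwise either some
  variable set is empty, so that its component is the zero ideal and its quotient works for all, or
  the two exhausting sets are the only ones.\<close>

lemma common_quotient:
  fixes f :: "'k::field mpoly" and V :: "'i \<Rightarrow> nat set"
  assumes nz: "\<And>v. v \<in> {1..d} \<Longrightarrow> \<alpha> v \<noteq> 0" and fin: "finite N"
    and sub: "\<And>i. i \<in> N \<Longrightarrow> V i \<subseteq> {1..d}"
    and disj: "\<And>i j. i \<in> N \<Longrightarrow> j \<in> N \<Longrightarrow> i \<noteq> j \<Longrightarrow> V i \<inter> V j = {}"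
    and g: "\<And>i. i \<in> N \<Longrightarrow> g i \<in> carrier (polynomial_ring d)"
    and eq: "\<And>i. i \<in> N \<Longrightarrow> f - linear_form d \<alpha> * g i \<in> var_ideal (V i)"
    and tangent: "\<And>i j v w. i \<in> N \<Longrightarrow> j \<in> N \<Longrightarrow> i \<noteq> j \<Longrightarrow> v \<in> {1..d} \<Longrightarrow> w \<in> {1..d} \<Longrightarrow>
      coeff (on_line (tangent \<alpha> v w) f) 1 = 0"
  shows "\<exists>G. \<forall>i\<in>N. f - linear_form d \<alpha> * G \<in> var_ideal (V i)"
proof (cases "\<exists>i\<in>N. \<exists>j\<in>N. i \<noteq> j \<and> {1..d} \<subseteq> V i \<union> V j")
  case False
  then have "linear_form d \<alpha> \<notin> var_ideal (V i \<union> V j)" if "i \<in> N" "j \<in> N" "i \<noteq> j" for i j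
    using linear_form_in_var_ideal[of d \<alpha> "V i \<union> V j"] nz that by blast
  then show ?thesis using eq fin by (intro glue_when_no_cover[of N f "linear_form d \<alpha>" g]) auto
next
  case True
  then obtain i j where ij: "i \<in> N" "j \<in> N" "i \<noteq> j" "{1..d} \<subseteq> V i \<union> V j" by blast
  then have U: "V i \<union> V j = {1..d}" using sub[of i] sub[of j] by blast
  show ?thesis
  proof (cases "\<exists>k\<in>N. V k = {}")
    case True
    then obtain k where k: "k \<in> N" "V k = {}" by blast
    then have "f - linear_form d \<alpha> * g k = 0" using eq[OF k(1)] by (auto simp: var_ideal_def)
    then show ?thesis by (intro exI[of _ "g k"]) (simp add: var_ideal_closed)
  next
    case ne: False
    have N: "N = {i, j}"
    proof -
      have "k \<in> {i, j}" if k: "k \<in> N" for k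
      proof (rule ccontr)
        assume "k \<notin> {i, j}"
        then have "V k \<inter> (V i \<union> V j) = {}" using disj[OF k] ij by blast
        then show False using sub[OF k] U ne k by blast
      qed
      then show ?thesis using ij by blast
    qed
    show ?thesis unfolding N
    proof (rule glue_two_covering[where \<alpha> = \<alpha> and d = d])
      show "V i \<inter> V j = {}" using disj ij by blast
      show "V i \<noteq> {}" "V j \<noteq> {}" using ne ij by blast+
      show "coeff (on_line (tangent \<alpha> v w) f) 1 = 0" if "v \<in> {1..d}" "w \<in> {1..d}" for v w
        using tangent ij that by blast
      show "f - linear_form d \<alpha> * g k \<in> var_ideal (V k)" "g k \<in> carrier (polynomial_ring d)"
        if "k \<in> {i, j}" for k
        using eq[of k] g[of k] that unfolding N by (simp_all only: simp_thms)
    qed (rule U nz | assumption)+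
  qed
qed

section \<open>Density of the points with nonzero coordinates\<close>

lemma poly_eval_cong:
  assumes "f \<in> carrier (polynomial_ring d)" "\<And>i. i \<in> {1..d} \<Longrightarrow> \<beta> i = \<gamma> i"
  shows "poly_eval \<beta> f = poly_eval \<gamma> f"
proof -
  have "\<beta> i = \<gamma> i" if "m \<in> mkeys f" "i \<in> mkeys m" for m i
  proof -
    have "mkeys m \<subseteq> {1..d}" using assms(1) that(1) by simp
    then have "i \<in> {1..d}" using that(2) by blast
    then show ?thesis by (rule assms(2))
  qed
  then show ?thesis
    unfolding poly_eval_def monom_eval_def
    by (intro sum.cong arg_cong2[of _ _ _ _ "(*)"] prod.cong refl) simp
qed

text \<open>A point \<open>\<beta>\<close> of a nonempty open set can be moved off the coordinate hyperplanes along the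
  diagonal line \<open>\<beta> + t (1, \<dots>, 1)\<close>: along it, the open condition and the nonvanishing of the
  coordinates exclude only the finitely many roots of a nonzero polynomial in \<open>t\<close>.\<close>

lemma nonzero_coordinates_dense:
  fixes d :: nat
  assumes inf: "infinite (UNIV :: 'k::field set)"
  defines "U \<equiv> {\<alpha> \<in> affine_space d. \<forall>i\<in>{1..d}. \<alpha> i \<noteq> (0 :: 'k)}"
  shows "openin (zariski_topology d) U"
    and "Abstract_Topology.closure_of (zariski_topology d) U = topspace (zariski_topology d)"
proof -
  let ?P = "\<Prod>i\<in>{1..d}. Var i ^ 1 :: 'k mpoly"
  have "mkeys ?P = {\<Sum>i\<in>{1..d}. Poly_Mapping.single i 1}"
    by (subst prod_Var_power) auto
  moreover have "mkeys (\<Sum>i\<in>{1..d}. Poly_Mapping.single i (1::nat)) \<subseteq> {1..d}"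
    using keys_sum[of "\<lambda>i. Poly_Mapping.single i (1::nat)" "{1..d}"] by auto
  ultimately have "?P \<in> carrier (polynomial_ring d)" by simp
  moreover have "poly_eval \<alpha> ?P = (\<Prod>i\<in>{1..d}. \<alpha> i)" for \<alpha>
  proof -
    have "poly_eval \<alpha> (\<Prod>i\<in>A. Var i) = (\<Prod>i\<in>A. \<alpha> i)" if "finite A" for A
      using that by (induction A rule: finite_induct)
        (simp_all add: poly_eval_mult Var_def poly_eval_single monom_eval_def)
    then show ?thesis by simp
  qed
  then have "U = affine_space d - zero_locus d {?P}"
    by (auto simp: U_def zero_locus_def)
  ultimately show "openin (zariski_topology d) U"
    unfolding openin_zariski_topology zariski_open_def by (intro exI[of _ "{?P}"]) simp
  have "\<exists>\<gamma>. \<gamma> \<in> U \<and> \<gamma> \<in> T" if \<beta>: "\<beta> \<in> T" and T: "openin (zariski_topology d) T" for \<beta> T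
  proof -
    obtain F where F: "F \<subseteq> carrier (polynomial_ring d)" "T = affine_space d - zero_locus d F"
      using T unfolding openin_zariski_topology zariski_open_def by blast
    then obtain f where f: "f \<in> F" "poly_eval \<beta> f \<noteq> 0"
      using \<beta> unfolding zero_locus_def by blast
    define q where "q = subst (\<lambda>c. [:c:]) (\<lambda>i. [:\<beta> i, 1:]) f * (\<Prod>i\<in>{1..d}. [:\<beta> i, 1:])"
    have ev: "poly (subst (\<lambda>c. [:c:]) (\<lambda>i. [:\<beta> i, 1:]) f) t = poly_eval (\<lambda>i. \<beta> i + t) f" for t
      by (simp add: poly_subst)
    have "subst (\<lambda>c. [:c:]) (\<lambda>i. [:\<beta> i, 1:]) f \<noteq> 0"
    proof
      assume "subst (\<lambda>c. [:c:]) (\<lambda>i. [:\<beta> i, 1:]) f = 0"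
      then have "poly_eval (\<lambda>i. \<beta> i + 0) f = 0" by (simp only: poly_0 flip: ev)
      then show False using f(2) by simp
    qed
    then have "q \<noteq> 0" by (simp add: q_def)
    then have "finite {t. poly q t = 0}" by (rule poly_roots_finite)
    then obtain t where "poly q t \<noteq> 0"
      using inf by (metis (mono_tags, lifting) UNIV_eq_I mem_Collect_eq)
    then have t: "poly_eval (\<lambda>i. \<beta> i + t) f \<noteq> 0" "\<forall>i\<in>{1..d}. \<beta> i + t \<noteq> 0"
      by (auto simp: q_def ev poly_prod)
    define \<gamma> where "\<gamma> = restrict (\<lambda>i. \<beta> i + t) {1..d}"
    have "poly_eval \<gamma> f = poly_eval (\<lambda>i. \<beta> i + t) f"
      using F(1) f(1) by (intro poly_eval_cong[of _ d]) (auto simp: \<gamma>_def)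
    moreover have "\<gamma> \<in> affine_space d" by (auto simp: \<gamma>_def affine_space_def)
    ultimately have "\<gamma> \<in> T" "\<gamma> \<in> U"
      using t f(1) F(2) by (auto simp: zero_locus_def U_def \<gamma>_def)
    then show ?thesis by blast
  qed
  then show "Abstract_Topology.closure_of (zariski_topology d) U = topspace (zariski_topology d)"
    unfolding closure_of_def by blast
qed

section \<open>Ideals of the polynomial ring\<close>

lemma genideal_Var_image:
  assumes "W \<subseteq> {1..d}"
  shows "Idl\<^bsub>polynomial_ring d\<^esub> ((Var :: nat \<Rightarrow> 'k::field mpoly) ` W)
    = carrier (polynomial_ring d) \<inter> var_ideal W"
proof
  let ?R = "polynomial_ring d :: 'k mpoly ring"
  interpret R: cring ?R by (rule polynomial_ring_cring)
  have Var: "(Var :: nat \<Rightarrow> 'k mpoly) ` W \<subseteq> carrier ?R"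
    using assms by (auto simp: Var_def)
  have "ideal (carrier ?R \<inter> var_ideal W) ?R"
  proof (rule idealI)
    show "ring ?R" by (rule R.ring_axioms)
    show "subgroup (carrier ?R \<inter> var_ideal W) (add_monoid ?R)"
    proof (rule R.add.subgroupI)
      fix f assume f: "f \<in> carrier ?R \<inter> var_ideal W"
      then have "\<ominus>\<^bsub>?R\<^esub> f + f = 0" using R.l_neg[of f] by simp
      then have "\<ominus>\<^bsub>?R\<^esub> f = 0 - f" by (simp add: eq_neg_iff_add_eq_0)
      then show "\<ominus>\<^bsub>?R\<^esub> f \<in> carrier ?R \<inter> var_ideal W"
        using f R.a_inv_closed[of f] var_ideal_closed(3)[OF var_ideal_closed(1), of f W]
        by (auto simp del: polynomial_ring_simps(1))
    next
      fix f g assume "f \<in> carrier ?R \<inter> var_ideal W" "g \<in> carrier ?R \<inter> var_ideal W"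
      then show "f \<oplus>\<^bsub>?R\<^esub> g \<in> carrier ?R \<inter> var_ideal W"
        using R.a_closed[of f g] var_ideal_closed(2)[of f W g]
        by (auto simp del: polynomial_ring_simps(1))
    qed (use var_ideal_closed(1) R.zero_closed in \<open>auto simp del: polynomial_ring_simps(1)\<close>)
  next
    fix f x assume "f \<in> carrier ?R \<inter> var_ideal W" "x \<in> carrier ?R"
    then show "x \<otimes>\<^bsub>?R\<^esub> f \<in> carrier ?R \<inter> var_ideal W" "f \<otimes>\<^bsub>?R\<^esub> x \<in> carrier ?R \<inter> var_ideal W"
      using R.m_closed[of x f] R.m_closed[of f x] var_ideal_closed(4,5)[of f W x]
      by (auto simp del: polynomial_ring_simps(1))
  qed
  moreover have "Var ` W \<subseteq> carrier ?R \<inter> var_ideal W" using Var by auto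
  ultimately show "Idl\<^bsub>?R\<^esub> (Var ` W) \<subseteq> carrier ?R \<inter> var_ideal W"
    by (rule R.genideal_minimal)
  interpret I: ideal "Idl\<^bsub>?R\<^esub> (Var ` W)" ?R by (rule R.genideal_ideal[OF Var])
  show "carrier ?R \<inter> var_ideal W \<subseteq> Idl\<^bsub>?R\<^esub> (Var ` W)"
  proof
    fix f assume f: "f \<in> carrier ?R \<inter> var_ideal W"
    have single: "Poly_Mapping.single m (mlookup f m) \<in> Idl\<^bsub>?R\<^esub> (Var ` W)" if m: "m \<in> mkeys f" for m
    proof -
      obtain v where v: "v \<in> mkeys m" "v \<in> W" using f m unfolding var_ideal_def by blast
      define u where "u = m - Poly_Mapping.single v 1"
      have mu: "m = u + Poly_Mapping.single v 1"
        using v by (intro poly_mapping_eqI)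
          (auto simp: u_def lookup_add lookup_minus lookup_single when_def in_keys_iff)
      have "mkeys u \<subseteq> mkeys m" using mu by (auto simp: in_keys_iff lookup_add)
      then have "Poly_Mapping.single u (mlookup f m) \<in> carrier ?R"
        using f m by simp blast
      moreover have "Var v \<in> Idl\<^bsub>?R\<^esub> (Var ` W)" using R.genideal_self[OF Var] v by blast
      ultimately have "Poly_Mapping.single u (mlookup f m) * Var v \<in> Idl\<^bsub>?R\<^esub> (Var ` W)"
        using I.I_l_closed unfolding polynomial_ring_simps(2) by blast
      moreover have "Poly_Mapping.single u c * Var v = (Poly_Mapping.single m c :: 'k mpoly)" for c
        unfolding mu by (simp add: Var_def mult_single)
      ultimately show ?thesis by (simp only:)
    qed
    have "(\<Sum>m\<in>M. Poly_Mapping.single m (mlookup f m)) \<in> Idl\<^bsub>?R\<^esub> (Var ` W)"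
      if "finite M" "M \<subseteq> mkeys f" for M
      using that
    proof (induction M rule: finite_induct)
      case empty then show ?case using I.zero_closed by (simp del: polynomial_ring_simps(1))
    next
      case (insert m M)
      then have "Poly_Mapping.single m (mlookup f m) + (\<Sum>m\<in>M. Poly_Mapping.single m (mlookup f m))
          \<in> Idl\<^bsub>?R\<^esub> (Var ` W)"
        using single I.a_closed unfolding polynomial_ring_simps(5) by blast
      then show ?case using insert by simp
    qed
    from this[of "mkeys f"] show "f \<in> Idl\<^bsub>?R\<^esub> (Var ` W)"
      by (simp del: polynomial_ring_simps(1) flip: poly_mapping_sum_single)
  qed
qed

text \<open>Killing the variables with index outside \<open>{1..d}\<close> is a retraction onto the polynomial ring in \<open>d\<close>
  variables, which brings quotients found among all polynomials back into that ring.\<close>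

lemma kill_vars_carrier:
  "kill_vars (- {1..d}) f \<in> carrier (polynomial_ring d)"
  "f \<in> carrier (polynomial_ring d) \<Longrightarrow> kill_vars (- {1..d}) f = f"
proof -
  have "mkeys m \<subseteq> {1..d}" if "m \<in> mkeys (kill_vars (- {1..d}) f)" for m
    using that by (cases "mkeys m \<inter> - {1..d} = {}") (blast, simp add: in_keys_iff lookup_kill_vars)
  then show "kill_vars (- {1..d}) f \<in> carrier (polynomial_ring d)"
    by (simp only: polynomial_ring_simps mem_Collect_eq) blast
  assume f: "f \<in> carrier (polynomial_ring d)"
  have "mlookup f m = 0" if "mkeys m \<inter> - {1..d} \<noteq> {}" for m
  proof -
    have "\<not> mkeys m \<subseteq> {1..d}" using that by blast
    then have "m \<notin> mkeys f" using f by auto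
    then show ?thesis by (simp add: in_keys_iff)
  qed
  then show "kill_vars (- {1..d}) f = f"
    by (intro poly_mapping_eqI) (simp only: lookup_kill_vars, metis)
qed

lemma linear_form_closed: "linear_form d \<alpha> \<in> carrier (polynomial_ring d)"
proof -
  have "kill_vars (- {1..d}) (linear_form d \<alpha>) = linear_form d \<alpha>"
    unfolding kill_vars_def Const_hom.subst_linear_form
    by (simp only: linear_form_def) (rule sum.cong, auto)
  then show ?thesis using kill_vars_carrier(1) by metis
qed

lemma kill_vars_var_ideal:
  assumes "f \<in> var_ideal W"
  shows "kill_vars W' f \<in> var_ideal W"
proof -
  have "mkeys (kill_vars W' f) \<subseteq> mkeys f"
    by (auto simp: in_keys_iff lookup_kill_vars split: if_splits)
  then show ?thesis using assms unfolding var_ideal_def by blast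
qed

lemma restrict_quotient:
  assumes "f \<in> carrier (polynomial_ring d)" "a \<in> carrier (polynomial_ring d)"
    and "f - a * g \<in> var_ideal W"
  shows "f - a * kill_vars (- {1..d}) g \<in> var_ideal W"
  using kill_vars_var_ideal[OF assms(3), of "- {1..d}"]
  unfolding kill_vars_simps kill_vars_carrier(2)[OF assms(1)] kill_vars_carrier(2)[OF assms(2)] .

section \<open>Integral closedness modulo a general linear form\<close>

theorem proposition4p4:
  fixes R :: "((nat \<Rightarrow>\<^sub>0 nat) \<Rightarrow>\<^sub>0 'k::field) ring"
    and d n :: nat
    and V :: "nat \<Rightarrow> nat set"
    and p :: "nat \<Rightarrow> ((nat \<Rightarrow>\<^sub>0 nat) \<Rightarrow>\<^sub>0 'k) set"
    and I :: "((nat \<Rightarrow>\<^sub>0 nat) \<Rightarrow>\<^sub>0 'k) set"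
  assumes "infinite (UNIV :: 'k set)"
    and "R = polynomial_ring d"
    and "\<And>i. i \<in> {1..n} \<Longrightarrow> V i \<subseteq> {1..d}"
    and "\<And>i j. i \<in> {1..n} \<Longrightarrow> j \<in> {1..n} \<Longrightarrow> i \<noteq> j \<Longrightarrow> V i \<inter> V j = {}"
    and "\<And>i. i \<in> {1..n} \<Longrightarrow> p i = Idl\<^bsub>R\<^esub> (Var ` V i)"
    and "I = carrier R \<inter> (\<Inter>i\<in>{1..n}. p i)"
  shows "holds_for_general_linear_form d
           (\<lambda>a. integrally_closed_ideal (R Quot (Idl\<^bsub>R\<^esub> {a}))
                  ((\<lambda>r. Idl\<^bsub>R\<^esub> {a} +>\<^bsub>R\<^esub> r) ` (I <+>\<^bsub>R\<^esub> Idl\<^bsub>R\<^esub> {a})))"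
proof -
  let ?U = "{\<alpha> \<in> affine_space d. \<forall>i\<in>{1..d}. \<alpha> i \<noteq> (0 :: 'k)}"
  have R: "cring R" using assms(2) polynomial_ring_cring by simp
  interpret cring R by (rule R)
  have carr: "carrier R = carrier (polynomial_ring d)" by (simp add: assms(2))
  have I_eq: "I = carrier R \<inter> (\<Inter>i\<in>{1..n}. var_ideal (V i))"
    using assms(3,5) unfolding assms(2,6) by (auto simp: genideal_Var_image simp del: polynomial_ring_simps)
  have Var_sub: "Var ` V i \<subseteq> carrier R" if "i \<in> {1..n}" for i
    using assms(3)[OF that] by (auto simp: assms(2) Var_def)
  have "ideal (\<Inter>(insert (carrier R) (p ` {1..n}))) R"
    using Var_sub genideal_ideal oneideal by (intro i_Intersect) (auto simp: assms(5))
  then have I: "ideal I R" by (simp add: assms(6))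
  have "integrally_closed_ideal (R Quot (Idl\<^bsub>R\<^esub> {a})) ((+>\<^bsub>R\<^esub>) (Idl\<^bsub>R\<^esub> {a}) ` (I <+>\<^bsub>R\<^esub> Idl\<^bsub>R\<^esub> {a}))"
    if nz: "\<And>i. i \<in> {1..d} \<Longrightarrow> \<alpha> i \<noteq> 0" and a_def: "a = linear_form d \<alpha>" for \<alpha> a
  proof -
    define A where "A = Idl\<^bsub>R\<^esub> {a}"
    have a: "a \<in> carrier R" using linear_form_closed assms(2) a_def by blast
    have A: "ideal A R" unfolding A_def using a by (intro genideal_ideal) auto
    have A_eq: "A = {a * g |g. g \<in> carrier R}"
      unfolding A_def cgenideal_eq_genideal[OF a, symmetric] cgenideal_def
      by (simp add: assms(2) mult.commute)
    have J_eq: "I <+>\<^bsub>R\<^esub> A = {q + a * g |q g. q \<in> I \<and> g \<in> carrier R}"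
      unfolding set_add_def' A_eq by (auto simp: assms(2))
    have J: "ideal (I <+>\<^bsub>R\<^esub> A) R" by (rule add_ideals[OF I A])
    have hom: "integral_over_principal b (subst h \<sigma> f)"
      if h: "coefficient_hom h" and ker: "subst h \<sigma> a = 0"
        and dvd: "\<And>q. q \<in> I \<Longrightarrow> b dvd subst h \<sigma> q"
        and f: "f \<in> carrier R" "A +>\<^bsub>R\<^esub> f \<in> integral_closure (R Quot A) ((+>\<^bsub>R\<^esub>) A ` (I <+>\<^bsub>R\<^esub> A))"
      for h :: "'k \<Rightarrow> 'b::comm_ring_1" and \<sigma> b f
    proof -
      interpret h: coefficient_hom h by (rule h)
      have "subst h \<sigma> x = 0" if "x \<in> A" for x
        using that ker unfolding A_eq by (auto simp: h.subst_mult)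
      moreover have "b dvd subst h \<sigma> x" if "x \<in> I <+>\<^bsub>R\<^esub> A" for x
        using that dvd ker unfolding J_eq by (auto simp: h.subst_add h.subst_mult)
      ultimately show ?thesis
        by (intro integral_closure_quotient_hom[OF R A J _ _ _ _ _ f])
          (simp_all add: assms(2) h.subst_add h.subst_mult)
    qed
    have main: "f \<in> I <+>\<^bsub>R\<^esub> A"
      if f: "f \<in> carrier R" and int: "A +>\<^bsub>R\<^esub> f \<in> integral_closure (R Quot A) ((+>\<^bsub>R\<^esub>) A ` (I <+>\<^bsub>R\<^esub> A))"
      for f
    proof -
      \<comment> \<open>Membership of \<open>f\<close> in \<open>p i + (a)\<close>, from a homomorphism with that kernel.\<close>
      have "\<exists>g\<in>carrier R. f - a * g \<in> var_ideal (V i)" if i: "i \<in> {1..n}" for i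
      proof -
        obtain \<sigma> :: "nat \<Rightarrow> 'k mpoly" where \<sigma>: "subst Const \<sigma> a = 0" "\<And>v. v \<in> V i \<Longrightarrow> \<sigma> v = 0"
          "\<And>f. \<exists>g. f - subst Const \<sigma> f - a * g \<in> var_ideal (V i)"
          using linear_section_of_var_ideal[of d \<alpha> "V i"] nz unfolding a_def by blast
        have "integral_over_principal 0 (subst Const \<sigma> f)"
        proof (rule hom[OF Const_hom.coefficient_hom_axioms \<sigma>(1) _ f int])
          fix q assume "q \<in> I"
          then have "q \<in> var_ideal (V i)" using i by (simp add: I_eq)
          then show "0 dvd subst Const \<sigma> q"
            using \<sigma>(2) by (simp add: Const_hom.subst_var_ideal)
        qed
        then have "subst Const \<sigma> f = 0" by (rule integral_over_zero)
        with \<sigma>(3)[of f] obtain g where "f - a * g \<in> var_ideal (V i)" by auto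
        then have "f - a * kill_vars (- {1..d}) g \<in> var_ideal (V i)"
          using restrict_quotient[of f d a g] f a by (simp only: carr)
        then show ?thesis using kill_vars_carrier(1)[of d g] unfolding carr by blast
      qed
      then obtain g where g: "\<And>i. i \<in> {1..n} \<Longrightarrow> g i \<in> carrier R"
        "\<And>i. i \<in> {1..n} \<Longrightarrow> f - a * g i \<in> var_ideal (V i)" by metis
      \<comment> \<open>The linear part of \<open>f\<close> vanishes on the hyperplane \<open>a = 0\<close> once there are two components.\<close>
      have tangent: "coeff (on_line (tangent \<alpha> v w) f) 1 = 0"
        if ij: "i \<in> {1..n}" "j \<in> {1..n}" "i \<noteq> j" and vw: "v \<in> {1..d}" "w \<in> {1..d}" for i j v w
      proof -
        have "integral_over_principal ([:0, 1:] ^ 2) (on_line (tangent \<alpha> v w) f)"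
          unfolding on_line_def
        proof (rule hom[OF const_poly_hom.coefficient_hom_axioms _ _ f int], fold on_line_def)
          show "on_line (tangent \<alpha> v w) a = 0"
            unfolding a_def by (rule on_line_tangent_linear_form[OF vw])
          fix q assume "q \<in> I"
          then show "[:0, 1:] ^ 2 dvd on_line (tangent \<alpha> v w) q"
            using ij assms(4)[OF ij] by (intro X_squared_dvd_on_line_tangent[of q "V i" "V j"]) (auto simp: I_eq)
        qed
        then show ?thesis using integral_over_X_squared X_squared_dvd_iff by blast
      qed
      \<comment> \<open>The quotients of \<open>f\<close> by \<open>a\<close> modulo the several \<open>p i\<close> are replaced by a single one.\<close>
      have "\<exists>G. \<forall>i\<in>{1..n}. f - a * G \<in> var_ideal (V i)"
        unfolding a_def
      proof (rule common_quotient[OF nz finite_atLeastAtMost assms(3) assms(4), where g = g])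
        show "g i \<in> carrier (polynomial_ring d)" if "i \<in> {1..n}" for i
          using g(1)[OF that] by (simp only: carr)
        show "f - linear_form d \<alpha> * g i \<in> var_ideal (V i)" if "i \<in> {1..n}" for i
          using g(2)[OF that] by (simp only: a_def)
      qed (assumption | rule tangent)+
      then obtain G where G: "\<And>i. i \<in> {1..n} \<Longrightarrow> f - a * G \<in> var_ideal (V i)" by blast
      let ?G = "kill_vars (- {1..d}) G"
      have Gc: "?G \<in> carrier R" unfolding carr by (rule kill_vars_carrier)
      have "f - a * ?G \<in> var_ideal (V i)" if "i \<in> {1..n}" for i
        using restrict_quotient[of f d a G] G[OF that] f a by (simp only: carr)
      moreover have "f - a * ?G \<in> carrier R"
      proof -
        have "kill_vars (- {1..d}) (f - a * G) = f - a * ?G"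
          using f a by (simp only: carr kill_vars_simps kill_vars_carrier(2))
        then show ?thesis using kill_vars_carrier(1)[of d "f - a * G"] by (simp only: carr)
      qed
      ultimately have "f - a * ?G \<in> I" by (simp add: I_eq)
      moreover have "f = (f - a * ?G) + a * ?G" by simp
      ultimately show ?thesis using Gc unfolding J_eq by blast
    qed
    have "cring (R Quot A)" by (rule ideal.quotient_is_cring[OF A R])
    moreover have id: "ideal ((+>\<^bsub>R\<^esub>) A ` (I <+>\<^bsub>R\<^esub> A)) (R Quot A)"
      by (rule ring_ideal_imp_quot_ideal[OF A J])
    ultimately have "(+>\<^bsub>R\<^esub>) A ` (I <+>\<^bsub>R\<^esub> A) \<subseteq> integral_closure (R Quot A) ((+>\<^bsub>R\<^esub>) A ` (I <+>\<^bsub>R\<^esub> A))"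
      by (rule ideal_subset_integral_closure)
    moreover have "X \<in> (+>\<^bsub>R\<^esub>) A ` (I <+>\<^bsub>R\<^esub> A)"
      if X: "X \<in> integral_closure (R Quot A) ((+>\<^bsub>R\<^esub>) A ` (I <+>\<^bsub>R\<^esub> A))" for X
    proof -
      have "X \<in> carrier (R Quot A)" using X by (simp add: integral_closure_def)
      then obtain f where "f \<in> carrier R" "X = A +>\<^bsub>R\<^esub> f"
        by (auto simp: FactRing_def A_RCOSETS_def')
      then show ?thesis using main X by blast
    qed
    ultimately show ?thesis
      using id unfolding integrally_closed_ideal_def A_def by blast
  qed
  then show ?thesis
    unfolding holds_for_general_linear_form_def
    using nonzero_coordinates_dense[OF assms(1), of d] by (intro exI[of _ ?U]) auto
qed

end
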